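(* Let $\lessdot$ be a shuffle order on $\mathcal{A}$. For any $\gamma\in(I^{\mathrm{plac}}_\lessdot)^\perp$, the power series $F^\lessdot_\gamma(\mathbf{x})$ is symmetric and \[ F^\lessdot_\gamma(\mathbf{x})=\sum_\nu s_\nu(\mathbf{x})\,\langle\mathfrak{J}^\lessdot_\nu(\mathbf{u}),\gamma\rangle, \] the sum over all partitions $\nu$.
   Context: $\mathcal{A}=\{1,\dots,N\}\sqcup\{\bar1,\dots,\bar N\}$; colored words are finite words in $\mathcal{A}$. A shuffle order is a total order $\lessdot$ on $\mathcal{A}$ with $1\lessdot\cdots\lessdot N$ and $\bar1\lessdot\cdots\lessdot\bar N$. $\mathcal{U}$ is the free associative $\mathbb{Z}$-algebra on noncommuting $u_x$, $x\in\mathcal{A}$, monomials identified with colored words. $\langle\cdot,\cdot\rangle$ is the bilinear form making colored words orthonormal; $(I)^\perp$ is the orthogonal complement in $\mathcal{U}$ of a subset $I$. $I^{\mathrm{plac}}_\lessdot$ is the two-sided ideal generated by: $xzy-zxy$ and $yxz-yzx$ for $x\lessdot y\lessdot z$; $yyx-yxy$ ($y$ unbarred, $x\lessdot y$); $zyy-yzy$ ($y$ unbarred, $y\lessdot z$); $yyz-yzy$ ($y$ barred, $y\lessdot z$); $xyy-yxy$ ($y$ barred, $x\lessdot y$). $y\succeq^\lessdot_{\mathrm{col}}x$ means $x\lessdot y$ or $x,y$ equal barred letters. $e^\lessdot_k(\mathbf{u})=\sum_{z_1\succeq^\lessdot_{\mathrm{col}}\cdots\succeq^\lessdot_{\mathrm{col}}z_k}u_{z_1}\cdots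 u_{z_k}$, $e^\lessdot_0=1$, $e^\lessdot_k=0$ ($k<0$); $\mathfrak{J}^\lessdot_\nu(\mathbf{u})=\sum_{\pi\in S_{\nu_1}}\mathrm{sgn}(\pi)\prod_{i=1}^{\nu_1}e^\lessdot_{\nu'_i+\pi(i)-i}(\mathbf{u})$ (product in increasing $i$, $\nu'$ the conjugate). $\mathrm{Des}_\lessdot(w)=\{i\in[t-1]: w_{i+1}\lessdot w_i\text{ or } w_i,w_{i+1}\text{ equal barred letters}\}$ for $w=w_1\cdots w_t$; $Q_D(\mathbf{x})=\sum x_{i_1}\cdots x_{i_t}$ over $1\le i_1\le\cdots\le i_t$ with $i_j<i_{j+1}$ for $j\in D$; for $\gamma=\sum_w\gamma_ww$, $F^\lessdot_\gamma(\mathbf{x})=\sum_w\gamma_wQ_{\mathrm{Des}_\lessdot(w)}(\mathbf{x})$. *)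

theory Defs
  imports
    "HOL-Library.Poly_Mapping"
    "HOL-Library.Multiset"
    "HOL-Algebra.Ideal"
    "HOL-Combinatorics.Permutations"
    "HOL-Analysis.Infinite_Sum"
begin

section \<open>Colored words\<close>

datatype letter = Unbarred nat | Barred nat

fun is_barred :: "letter \<Rightarrow> bool" where
  "is_barred (Unbarred i) \<longleftrightarrow> False"
| "is_barred (Barred i) \<longleftrightarrow> True"

definition alphabet :: "nat \<Rightarrow> letter set" where
  "alphabet N = Unbarred ` {1..N} \<union> Barred ` {1..N}"

text \<open>The relation \<open>lt\<close> is the strict order; its values outside the alphabet are irrelevant.\<close>

definition shuffle_order :: "nat \<Rightarrow> (letter \<Rightarrow> letter \<Rightarrow> bool) \<Rightarrow> bool" where
  "shuffle_order N lt \<longleftrightarrow>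
     irreflp_on (alphabet N) lt \<and> transp_on (alphabet N) lt \<and> totalp_on (alphabet N) lt \<and>
     (\<forall>i j. 1 \<le> i \<and> i < j \<and> j \<le> N \<longrightarrow>
        lt (Unbarred i) (Unbarred j) \<and> lt (Barred i) (Barred j))"


section \<open>The free associative algebra\<close>

text \<open>
  Words form a monoid under concatenation, written additively so that the convolution
  product of \<^theory>\<open>HOL-Library.Poly_Mapping\<close> makes \<open>letter list \<Rightarrow>\<^sub>0 int\<close> the
  free associative \<open>\<int>\<close>-algebra on \<open>letter\<close>.
\<close>

instantiation list :: (type) monoid_add
begin

definition zero_list :: "'a list" where "zero_list = []"
definition plus_list :: "'a list \<Rightarrow> 'a list \<Rightarrow> 'a list" where "plus_list v w = v @ w"

instance
  by standard (simp_all add: zero_list_def plus_list_def)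

end

type_synonym nc_poly = "letter list \<Rightarrow>\<^sub>0 int"

definition u :: "letter \<Rightarrow> nc_poly" where
  "u x = Poly_Mapping.single [x] 1"

definition word_monom :: "letter list \<Rightarrow> nc_poly" where
  "word_monom w = prod_list (map u w)"

lemma word_monom_eq_single: "word_monom w = Poly_Mapping.single w 1"
proof (induction w)
  case Nil
  then show ?case
    by (simp add: word_monom_def single_one[symmetric] zero_list_def del: single_one)
next
  case (Cons x w)
  then show ?case
    by (simp add: word_monom_def u_def mult_single plus_list_def)
qed

definition U_carrier :: "nat \<Rightarrow> nc_poly set" where
  "U_carrier N = {f. Poly_Mapping.keys f \<subseteq> lists (alphabet N)}"

definition U :: "nat \<Rightarrow> nc_poly ring" where
  "U N = \<lparr>carrier = U_carrier N, monoid.mult = (*), one = 1, zero = 0, add = (+)\<rparr>"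

lemma U_carrier_mult:
  assumes "f \<in> U_carrier N" "g \<in> U_carrier N"
  shows "f * g \<in> U_carrier N"
proof -
  have "v + w \<in> lists (alphabet N)" if "v \<in> Poly_Mapping.keys f" "w \<in> Poly_Mapping.keys g" for v w
    using assms that unfolding U_carrier_def plus_list_def by auto
  then show ?thesis
    using keys_mult[of f g] unfolding U_carrier_def by blast
qed

lemma ring_U: "ring (U N)"
proof (rule ringI)
  show "abelian_group (U N)"
  proof (rule abelian_groupI)
    fix f g assume "f \<in> carrier (U N)" "g \<in> carrier (U N)"
    then show "f \<oplus>\<^bsub>U N\<^esub> g \<in> carrier (U N)"
      using Poly_Mapping.keys_add[of f g] by (auto simp: U_def U_carrier_def)
  next
    fix f assume "f \<in> carrier (U N)"
    then show "\<exists>g\<in>carrier (U N). g \<oplus>\<^bsub>U N\<^esub> f = \<zero>\<^bsub>U N\<^esub>"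
      by (intro bexI[of _ "- f"]) (auto simp: U_def U_carrier_def)
  qed (auto simp: U_def U_carrier_def ac_simps)
  show "monoid (U N)"
  proof (rule monoidI)
    show "\<one>\<^bsub>U N\<^esub> \<in> carrier (U N)"
      by (simp add: U_def U_carrier_def zero_list_def)
  qed (auto simp: U_def U_carrier_mult mult.assoc)
qed (auto simp: U_def algebra_simps)

text \<open>The bilinear form for which the words are orthonormal.\<close>

definition pairing :: "nc_poly \<Rightarrow> nc_poly \<Rightarrow> int" where
  "pairing f g = (\<Sum>w\<in>Poly_Mapping.keys f. Poly_Mapping.lookup f w * Poly_Mapping.lookup g w)"

definition orth_compl :: "nat \<Rightarrow> nc_poly set \<Rightarrow> nc_poly set" where
  "orth_compl N I = {g \<in> carrier (U N). \<forall>f\<in>I. pairing f g = 0}"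


section \<open>The plactic ideal\<close>

definition plac_gens :: "nat \<Rightarrow> (letter \<Rightarrow> letter \<Rightarrow> bool) \<Rightarrow> nc_poly set" where
  "plac_gens N lt =
     {word_monom [x, z, y] - word_monom [z, x, y] | x y z.
        {x, y, z} \<subseteq> alphabet N \<and> lt x y \<and> lt y z} \<union>
     {word_monom [y, x, z] - word_monom [y, z, x] | x y z.
        {x, y, z} \<subseteq> alphabet N \<and> lt x y \<and> lt y z} \<union>
     {word_monom [y, y, x] - word_monom [y, x, y] | x y.
        {x, y} \<subseteq> alphabet N \<and> \<not> is_barred y \<and> lt x y} \<union>
     {word_monom [z, y, y] - word_monom [y, z, y] | y z.
        {y, z} \<subseteq> alphabet N \<and> \<not> is_barred y \<and> lt y z} \<union>
     {word_monom [y, y, z] - word_monom [y, z, y] | y z.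
        {y, z} \<subseteq> alphabet N \<and> is_barred y \<and> lt y z} \<union>
     {word_monom [x, y, y] - word_monom [y, x, y] | x y.
        {x, y} \<subseteq> alphabet N \<and> is_barred y \<and> lt x y}"

text \<open>Ideals in \<^theory>\<open>HOL-Algebra.Ideal\<close> are two-sided.\<close>

definition plac_ideal :: "nat \<Rightarrow> (letter \<Rightarrow> letter \<Rightarrow> bool) \<Rightarrow> nc_poly set" where
  "plac_ideal N lt = genideal (U N) (plac_gens N lt)"


section \<open>Partitions\<close>

definition is_partition :: "nat list \<Rightarrow> bool" where
  "is_partition \<nu> \<longleftrightarrow> sorted_wrt (\<ge>) \<nu> \<and> 0 \<notin> set \<nu>"

definition first_part :: "nat list \<Rightarrow> nat" where
  "first_part \<nu> = (if \<nu> = [] then 0 else hd \<nu>)"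

text \<open>The part \<open>\<nu>'\<^sub>i\<close> of the conjugate partition, for \<open>i \<ge> 1\<close>.\<close>

definition conj_part :: "nat list \<Rightarrow> nat \<Rightarrow> nat" where
  "conj_part \<nu> i = card {r. r < length \<nu> \<and> i \<le> \<nu> ! r}"


section \<open>Noncommutative elementary and Schur functions\<close>

definition col_ge :: "(letter \<Rightarrow> letter \<Rightarrow> bool) \<Rightarrow> letter \<Rightarrow> letter \<Rightarrow> bool" where
  "col_ge lt y x \<longleftrightarrow> lt x y \<or> (x = y \<and> is_barred x)"

definition nc_e :: "nat \<Rightarrow> (letter \<Rightarrow> letter \<Rightarrow> bool) \<Rightarrow> int \<Rightarrow> nc_poly" where
  "nc_e N lt k =
     (if k < 0 then 0
      else \<Sum>w | w \<in> lists (alphabet N) \<and> length w = nat k \<and> successively (col_ge lt) w.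
             word_monom w)"

lemma nc_e_0: "nc_e N lt 0 = 1"
proof -
  have "{w. w \<in> lists (alphabet N) \<and> length w = nat 0 \<and> successively (col_ge lt) w} = {[]}"
    by auto
  then show ?thesis
    by (simp add: nc_e_def word_monom_def)
qed

text \<open>The factors do not commute; the list fixes the order of the product.\<close>

definition nc_schur :: "nat \<Rightarrow> (letter \<Rightarrow> letter \<Rightarrow> bool) \<Rightarrow> nat list \<Rightarrow> nc_poly" where
  "nc_schur N lt \<nu> =
     (\<Sum>\<pi> | \<pi> permutes {1..first_part \<nu>}.
        of_int (sign \<pi>) *
        prod_list (map (\<lambda>i. nc_e N lt (int (conj_part \<nu> i) + int (\<pi> i) - int i))
                       [1..<Suc (first_part \<nu>)]))"


section \<open>Formal power series in the variables \<open>x\<^sub>1, x\<^sub>2, \<dots>\<close>\<close>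

text \<open>
  The monomial \<open>x\<^bsub>i\<^sub>1\<^esub> \<cdots> x\<^bsub>i\<^sub>t\<^esub>\<close> is the multiset of its indices,
  and a series is the function giving its coefficients. There is no variable \<open>x\<^sub>0\<close>:
  the series below have coefficient \<open>0\<close> at every multiset containing \<open>0\<close>.
\<close>

type_synonym power_series = "nat multiset \<Rightarrow> int"

definition symmetric_series :: "power_series \<Rightarrow> bool" where
  "symmetric_series f \<longleftrightarrow> (\<forall>\<pi> m. \<pi> permutes {1..} \<longrightarrow> f (image_mset \<pi> m) = f m)"

text \<open>
  As in \<open>Des\<close>, the elements of \<open>D\<close> are positions counted from \<open>1\<close>, while \<open>!\<close> counts from \<open>0\<close>.
  \<open>Q\<^sub>D\<close> depends on the degree \<open>t\<close> as well as on \<open>D\<close>.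
\<close>

definition Q :: "nat \<Rightarrow> nat set \<Rightarrow> power_series" where
  "Q t D m = int (card {is. length is = t \<and> 0 \<notin> set is \<and> sorted is \<and>
                            (\<forall>j\<in>D. is ! (j - 1) < is ! j) \<and> mset is = m})"

definition Des :: "(letter \<Rightarrow> letter \<Rightarrow> bool) \<Rightarrow> letter list \<Rightarrow> nat set" where
  "Des lt w = {i \<in> {1..<length w}.
                 lt (w ! i) (w ! (i - 1)) \<or> (w ! (i - 1) = w ! i \<and> is_barred (w ! i))}"

definition F_series :: "(letter \<Rightarrow> letter \<Rightarrow> bool) \<Rightarrow> nc_poly \<Rightarrow> power_series" where
  "F_series lt \<gamma> m =
     (\<Sum>w\<in>Poly_Mapping.keys \<gamma>. Poly_Mapping.lookup \<gamma> w * Q (length w) (Des lt w) m)"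

definition cells :: "nat list \<Rightarrow> (nat \<times> nat) set" where
  "cells \<nu> = {(r, c). r < length \<nu> \<and> c < \<nu> ! r}"

text \<open>Semistandard tableaux are extended by \<open>0\<close> outside the diagram, so that they can be counted.\<close>

definition ssyt :: "nat list \<Rightarrow> (nat \<times> nat \<Rightarrow> nat) \<Rightarrow> bool" where
  "ssyt \<nu> T \<longleftrightarrow>
     (\<forall>p\<in>cells \<nu>. 1 \<le> T p) \<and> (\<forall>p. p \<notin> cells \<nu> \<longrightarrow> T p = 0) \<and>
     (\<forall>r c c'. (r, c) \<in> cells \<nu> \<and> (r, c') \<in> cells \<nu> \<and> c < c' \<longrightarrow> T (r, c) \<le> T (r, c')) \<and>
     (\<forall>r r' c. (r, c) \<in> cells \<nu> \<and> (r', c) \<in> cells \<nu> \<and> r < r' \<longrightarrow> T (r, c) < T (r', c))"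

definition schur :: "nat list \<Rightarrow> power_series" where
  "schur \<nu> m = int (card {T. ssyt \<nu> T \<and> image_mset T (mset_set (cells \<nu>)) = m})"

end

theory Submission
  imports Defs
begin

text \<open>
  Every \<open>\<gamma>\<close> orthogonal to the plactic ideal defines a linear functional on the quotient algebra. There the
  \<open>e\<^sub>k\<close> commute, by induction on the letters: for a letter \<open>z\<close> above all letters of \<open>B\<close> the plactic relations give
  \<open>[z, e\<^sub>k(B)] \<equiv> [z, e\<^sub>1(B)] e\<^sub>k\<^sub>-\<^sub>1(B)\<close>, and \<open>[z, e\<^sub>1(B)]\<close> is annihilated by \<open>z\<close> from the left if \<open>z\<close> is
  unbarred and from the right if it is barred.

  Let \<open>h\<^sub>k\<close> be the sum of the words of length \<open>k\<close> without descents, so that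
  \<open>\<Sum>\<^sub>i (-1)\<^sup>i e\<^sub>i h\<^sub>k\<^sub>-\<^sub>i = 0\<close> for \<open>k > 0\<close>. The coefficient of \<open>x\<^sup>m\<close> in the series of \<open>\<gamma>\<close> pairs \<open>\<gamma>\<close> with the product of the
  \<open>h\<^bsub>m\<^sub>i\<^esub>\<close>, whose order is immaterial modulo the ideal; this gives symmetry. The expansion is then an identity between
  polynomials in commuting \<open>e\<^sub>k\<close>: iterating the Pieri rule \<open>h\<^sub>k s\<^sub>\<mu> = \<Sum> s\<^sub>\<nu>\<close> over horizontal strips for the determinants
  \<open>s\<^sub>\<nu> = det (e\<^bsub>\<nu>'\<^sub>i + j - i\<^esub>)\<close> counts the tableaux of each shape.
\<close>

section \<open>Commuting elementary functions modulo the plactic relations\<close>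


text \<open>Single letters do not commute modulo the ideal, so the inductive step must dispose of
  the cross terms in a commutator of two elements \<open>e_k(B) + z e_j(B)\<close>. The congruence
  for \<open>[z, e_k(B)]\<close> turns them into multiples of \<open>D = [z, e_1(B)]\<close>: a
  factor \<open>D\<close> next to \<open>z\<close> on the annihilated side gives an element of the
  ideal, and the remaining terms combine into \<open>D\<close> times a commutator already known to
  lie there. The side depends on \<open>z\<close> because a barred letter may repeat in a column
  word and an unbarred one may not, which gives the two kinds different recursions for
  \<open>e_k\<close>. The ideal in which all this takes place is the largest one on which the
  pairing with \<open>\<gamma>\<close> vanishes; it contains the plactic generators. The
  combinatorics runs over single tableaux instead of shapes. With column lengths as a plain
  function, the Pieri rule adds one strip of largest entries to each tableau, and shapes enter only
  when tableaux are grouped at the end.\<close>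

locale ring_ideal =
  fixes I :: "'a::ring_1 set"
  assumes zero_mem [simp]: "0 \<in> I"
    and add_mem: "a \<in> I \<Longrightarrow> b \<in> I \<Longrightarrow> a + b \<in> I"
    and lmult_mem: "b \<in> I \<Longrightarrow> a * b \<in> I"
    and rmult_mem: "a \<in> I \<Longrightarrow> a * b \<in> I"
begin

lemma uminus_mem: "a \<in> I \<Longrightarrow> - a \<in> I"
  using lmult_mem[of a "- 1"] by simp

lemma diff_mem: "a \<in> I \<Longrightarrow> b \<in> I \<Longrightarrow> a - b \<in> I"
  using add_mem[of a "- b"] uminus_mem[of b] by simp

lemma sum_mem: "(\<And>i. i \<in> S \<Longrightarrow> f i \<in> I) \<Longrightarrow> sum f S \<in> I"
  by (induction S rule: infinite_finite_induct) (auto intro: add_mem)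

lemmas mem_intros = add_mem diff_mem lmult_mem rmult_mem

lemma diff_trans: "a - b \<in> I \<Longrightarrow> b - c \<in> I \<Longrightarrow> a - c \<in> I"
  using add_mem[of "a - b" "b - c"] by simp

lemma diff_sym: "a - b \<in> I \<Longrightarrow> b - a \<in> I"
  using uminus_mem[of "a - b"] by simp

lemma diff_mult:
  assumes "a - a' \<in> I" "b - b' \<in> I"
  shows "a * b - a' * b' \<in> I"
proof -
  have "a * b - a' * b' = (a - a') * b + a' * (b - b')"
    by (simp add: algebra_simps)
  then show ?thesis
    using assms by (auto intro: mem_intros)
qed

end

text \<open>Transitivity and irreflexivity give a finite set a maximal letter, and totality makes it
  the greatest. Sets thus grow by a new largest letter, the case in which a recursion for
  \<open>e_on\<close> is available.\<close>

lemma shuffle_order_induct [consumes 5, case_names empty insert]: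
  assumes ord: "transp_on X lt" "irreflp_on X lt" "totalp_on X lt"
    and A: "finite A" "A \<subseteq> X"
    and empty: "P {}"
    and step: "\<And>z B. finite B \<Longrightarrow> z \<notin> B \<Longrightarrow> insert z B \<subseteq> X \<Longrightarrow> (\<And>x. x \<in> B \<Longrightarrow> lt x z) \<Longrightarrow> P B
      \<Longrightarrow> P (insert z B)"
  shows "P A"
  using A
proof (induction "card A" arbitrary: A)
  case 0
  then show ?case using empty by simp
next
  case (Suc n)
  have "transp_on A lt" "asymp_on A lt"
    using Suc.prems ord
    using asymp_on_iff_irreflp_on_if_transp_on transp_on_subset irreflp_on_subset by blast+
  moreover have "A \<noteq> {}" using Suc.hyps(2) by auto
  ultimately obtain z where z: "z \<in> A" "\<And>x. x \<in> A \<Longrightarrow> x \<noteq> z \<Longrightarrow> \<not> lt z x"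
    using Finite_Set.bex_max_element[of A lt] Suc.prems by blast
  have "P (insert z (A - {z}))"
  proof (rule step)
    show "P (A - {z})"
      by (rule Suc.hyps(1)) (use Suc.hyps(2) Suc.prems z(1) in \<open>auto simp: card_Diff_singleton\<close>)
    show "lt x z" if "x \<in> A - {z}" for x
      using that z ord(3) Suc.prems(2) by (auto simp: totalp_on_def)
  qed (use Suc.prems z(1) in auto)
  then show ?case using z(1) by (simp add: insert_absorb)
qed

section \<open>Elementary functions of a subset of the letters\<close>

definition e_on :: "(letter \<Rightarrow> letter \<Rightarrow> bool) \<Rightarrow> letter set \<Rightarrow> int \<Rightarrow> nc_poly" where
  "e_on lt A k =
     (if k < 0 then 0
      else \<Sum>w | w \<in> lists A \<and> length w = nat k \<and> successively (col_ge lt) w. word_monom w)"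

lemma nc_e_eq_e_on: "nc_e N lt = e_on lt (alphabet N)"
  by (simp add: nc_e_def e_on_def fun_eq_iff)

lemma finite_words [simp]: "finite A \<Longrightarrow> finite {w. w \<in> lists A \<and> length w = k \<and> P w}"
  by (rule finite_subset[OF _ finite_lists_length_eq[of A k]]) auto

lemma word_monom_Cons: "word_monom (x # w) = u x * word_monom w"
  by (simp add: word_monom_def)

lemma e_on_neg [simp]: "k < 0 \<Longrightarrow> e_on lt A k = 0"
  by (simp add: e_on_def)

lemma e_on_0 [simp]: "e_on lt A 0 = 1"
proof -
  have "{w. w \<in> lists A \<and> w = [] \<and> successively (col_ge lt) w} = {[]}"
    by auto
  then show ?thesis
    by (simp add: e_on_def word_monom_def)
qed

lemma e_on_empty [simp]: "k \<noteq> 0 \<Longrightarrow> e_on lt {} k = 0"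
  by (auto simp: e_on_def intro!: sum.neutral)

text \<open>The word descends along \<open>col_ge\<close>, so a letter following one from
  \<open>A\<close> is smaller than or equal to it and cannot be the top letter
  \<open>z\<close>.\<close>

lemma chain_avoids_max:
  assumes "successively (col_ge lt) w" "w \<in> lists (insert z A)"
    and "\<And>x. x \<in> A \<Longrightarrow> \<not> lt z x" "w \<noteq> [] \<Longrightarrow> hd w \<in> A" "z \<notin> A"
  shows "w \<in> lists A"
  using assms(1,2,4)
proof (induction w)
  case (Cons a w)
  have "hd w \<in> A" if "w \<noteq> []"
    using that Cons.prems assms(3,5) by (cases w) (auto simp: col_ge_def successively_Cons)
  then show ?case using Cons by (auto simp: successively_Cons)
qed simp

text \<open>In a word descending along \<open>col_ge\<close>, the copies of the top letter
  \<open>z\<close> stand at the front. Removing the first one leaves a word in which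
  \<open>z\<close> may occur again exactly when it is barred.\<close>

lemma e_on_insert_max:
  assumes A: "finite A" "z \<notin> A" and lt: "\<And>x. x \<in> A \<Longrightarrow> lt x z" "\<And>x. x \<in> A \<Longrightarrow> \<not> lt z x" "\<not> lt z z"
  shows "e_on lt (insert z A) k =
    e_on lt A k + u z * e_on lt (if is_barred z then insert z A else A) (k - 1)"
proof (cases "k \<le> 0")
  case True
  then show ?thesis by (cases "k = 0") auto
next
  case False
  define B where "B = (if is_barred z then insert z A else A)"
  define j where "j = nat (k - 1)"
  have j: "nat k = Suc j" using False by (simp add: j_def)
  let ?W = "\<lambda>C k. {w. w \<in> lists C \<and> length w = k \<and> successively (col_ge lt) w}"
  have "?W (insert z A) (Suc j) = ?W A (Suc j) \<union> Cons z ` ?W B j" (is "?L = ?R")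
  proof (rule Set.set_eqI, rule iffI)
    fix w assume w: "w \<in> ?L"
    then obtain a v where av: "w = a # v" by (cases w) auto
    show "w \<in> ?R"
    proof (cases "a = z")
      case True
      have "v \<in> lists B"
      proof (cases "is_barred z")
        case False
        have "v \<in> lists A"
        proof (rule chain_avoids_max[of lt v z A])
          show "hd v \<in> A" if "v \<noteq> []"
            using that w lt(3) False True by (cases v) (auto simp: av col_ge_def)
        qed (use w A lt in \<open>auto simp: av successively_Cons\<close>)
        then show ?thesis using False by (simp add: B_def)
      qed (use w in \<open>simp add: av B_def\<close>)
      then show ?thesis using w True by (auto simp: av successively_Cons)
    next
      case False
      then have "w \<in> lists A"
        using w A lt by (intro chain_avoids_max[of lt w z A]) (auto simp: av)
      then show ?thesis using w by simp
    qed
  next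
    fix w assume "w \<in> ?R"
    then consider "w \<in> ?W A (Suc j)" | v where "w = z # v" "v \<in> ?W B j" by auto
    then show "w \<in> ?L"
    proof cases
      case 1
      then show ?thesis by auto
    next
      case 2
      have "col_ge lt z (hd v)" if "v \<noteq> []"
        using that 2 lt(1) by (cases v) (auto simp: col_ge_def B_def split: if_splits)
      then show ?thesis using 2 by (auto simp: successively_Cons B_def split: if_splits)
    qed
  qed
  moreover have "?W A (Suc j) \<inter> Cons z ` ?W B j = {}" using A by auto
  moreover have "finite B" using A by (simp add: B_def)
  ultimately have "sum word_monom (?W (insert z A) (Suc j)) =
      sum word_monom (?W A (Suc j)) + u z * sum word_monom (?W B j)"
    using A by (simp add: sum.union_disjoint sum.reindex word_monom_Cons sum_distrib_left)
  then show ?thesis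
    using False by (simp add: e_on_def j flip: B_def j_def)
qed

section \<open>Commutators and the plactic relations\<close>

definition commutator :: "'a::ring \<Rightarrow> 'a \<Rightarrow> 'a" where
  "commutator a b = a * b - b * a"

text \<open>The terms with \<open>d\<close>, \<open>a2\<close>, \<open>b2\<close> cancel. With
  \<open>d\<close> the commutator sum and \<open>a\<close>, \<open>a1\<close>, \<open>a2\<close>
  standing for \<open>e_k\<close>, \<open>e_(k-1)\<close>, \<open>e_(k-2)\<close> over the smaller
  alphabet (likewise for \<open>b\<close>), every summand on the right lies in the ideal by
  itself.\<close>

lemma commutator_expand_unbarred:
  fixes y d a a1 a2 b b1 b2 :: "'a::ring"
  shows "commutator (a + y * a1) (b + y * b1) =
    commutator a b + y * commutator a b1 + y * commutator a1 b
    + y * y * commutator a1 b1 - d * commutator a1 b1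
    - (commutator y a - d * a1) * b1 + (commutator y b - d * b1) * a1
    - y * ((commutator y a1 - d * a2) * b1) + y * ((commutator y b1 - d * b2) * a1)
    - y * d * (a2 * b1) + y * d * (b2 * a1)"
  by (simp add: commutator_def ring_distribs mult.assoc)

text \<open>Here \<open>a\<close>, \<open>a1\<close>, \<open>a2\<close> belong to the enlarged
  alphabet, while \<open>a - y * a1\<close> and \<open>a1 - y * a2\<close> belong to the smaller
  one. The commutators over the enlarged alphabet that remain on the right have smaller total
  degree.\<close>

lemma commutator_expand_barred:
  fixes y d a a1 a2 b b1 b2 :: "'a::ring"
  shows "commutator a b =
    commutator (a - y * a1) (b - y * b1) + y * commutator a b1 + y * commutator a1 b
    - (commutator y (a - y * a1) - d * (a1 - y * a2)) * b1
    + (commutator y (b - y * b1) - d * (b1 - y * b2)) * a1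
    + d * y * (a2 * b1) - d * y * (b2 * a1) - (d + y * y) * commutator a1 b1"
  by (simp add: commutator_def ring_distribs mult.assoc)

text \<open>Up to sign and renaming, each of the six families of generators is a one-sided multiple
  of a commutator \<open>[u z, u x]\<close> with \<open>x\<close> below \<open>z\<close>: three have
  the extra letter on the right, three on the left. That letter lies strictly between
  \<open>x\<close> and \<open>z\<close> or equals one of them, its colour deciding which.\<close>

locale plactic_ideal = ring_ideal I for I :: "nc_poly set" +
  fixes X :: "letter set" and lt :: "letter \<Rightarrow> letter \<Rightarrow> bool"
  assumes trans: "transp_on X lt" and irrefl: "irreflp_on X lt" and total: "totalp_on X lt"
    and commutator_times: "\<And>x y z. {x, y, z} \<subseteq> X \<Longrightarrow>
      lt x y \<and> lt y z \<or> lt x z \<and> y = x \<and> \<not> is_barred y \<or> lt x z \<and> y = z \<and> is_barred y \<Longrightarrow>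
      commutator (u z) (u x) * u y \<in> I"
    and times_commutator: "\<And>x y z. {x, y, z} \<subseteq> X \<Longrightarrow>
      lt x y \<and> lt y z \<or> lt x z \<and> y = z \<and> \<not> is_barred y \<or> lt x z \<and> y = x \<and> is_barred y \<Longrightarrow>
      u y * commutator (u z) (u x) \<in> I"
begin

lemma asym: "x \<in> X \<Longrightarrow> y \<in> X \<Longrightarrow> lt x y \<Longrightarrow> \<not> lt y x"
  using transp_onD[OF trans, of x y x] irreflp_onD[OF irrefl, of x] by blast

lemma e_on_insert:
  assumes "finite A" "insert z A \<subseteq> X" "\<And>x. x \<in> A \<Longrightarrow> lt x z"
  shows "e_on lt (insert z A) k =
    e_on lt A k + u z * e_on lt (if is_barred z then insert z A else A) (k - 1)"
proof (rule e_on_insert_max)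
  show "\<not> lt z z" using assms irrefl by (auto dest: irreflp_onD)
  then show "z \<notin> A" using assms(3) by blast
  show "\<not> lt z x" if "x \<in> A" for x
    using asym[of x z] that assms by blast
qed (use assms in auto)

lemma e_on_insert_unbarred:
  assumes "finite A" "insert z A \<subseteq> X" "\<And>x. x \<in> A \<Longrightarrow> lt x z" "\<not> is_barred z"
  shows "e_on lt (insert z A) k = e_on lt A k + u z * e_on lt A (k - 1)"
  using e_on_insert[OF assms(1-3)] assms(4) by simp

lemma e_on_insert_barred:
  assumes "finite A" "insert z A \<subseteq> X" "\<And>x. x \<in> A \<Longrightarrow> lt x z" "is_barred z"
  shows "e_on lt (insert z A) k = e_on lt A k + u z * e_on lt (insert z A) (k - 1)"
  using e_on_insert[OF assms(1-3), of k] unfolding if_P[OF assms(4)] .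

text \<open>For finite \<open>A\<close> this is \<open>[u z, e_on lt A 1]\<close>, since
  \<open>e_on lt A 1\<close> is the sum of the letters of \<open>A\<close>.\<close>

definition commutator_sum :: "letter \<Rightarrow> letter set \<Rightarrow> nc_poly" where
  "commutator_sum z A = (\<Sum>x\<in>A. commutator (u z) (u x))"

lemma commutator_sum_times_mem:
  assumes "insert z A \<subseteq> X" "y \<in> X"
    and "\<And>x. x \<in> A \<Longrightarrow>
      lt x y \<and> lt y z \<or> lt x z \<and> y = x \<and> \<not> is_barred y \<or> lt x z \<and> y = z \<and> is_barred y"
  shows "commutator_sum z A * u y \<in> I"
  unfolding commutator_sum_def sum_distrib_right using assms
  by (intro sum_mem commutator_times) auto

lemma times_commutator_sum_mem:
  assumes "insert z A \<subseteq> X" "y \<in> X"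
    and "\<And>x. x \<in> A \<Longrightarrow>
      lt x y \<and> lt y z \<or> lt x z \<and> y = z \<and> \<not> is_barred y \<or> lt x z \<and> y = x \<and> is_barred y"
  shows "u y * commutator_sum z A \<in> I"
  unfolding commutator_sum_def sum_distrib_left using assms
  by (intro sum_mem times_commutator) auto

text \<open>Induction adds the largest letter \<open>y\<close> of \<open>A\<close>. As
  \<open>y\<close> is still below \<open>z\<close>, the relations let it annihilate commutator sums
  of \<open>z\<close>, and the recursion of \<open>e_on\<close> in \<open>y\<close> reduces the
  claim to the smaller set.\<close>

lemma commutator_e_on:
  assumes A: "finite A" "A \<subseteq> X" and z: "z \<in> X" "\<And>x. x \<in> A \<Longrightarrow> lt x z"
  shows "commutator (u z) (e_on lt A k) - commutator_sum z A * e_on lt A (k - 1) \<in> I"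
proof -
  have "(\<forall>x\<in>A. lt x z) \<longrightarrow> (\<forall>k. commutator (u z) (e_on lt A k) - commutator_sum z A * e_on lt A (k - 1) \<in> I)"
    using trans irrefl total A
  proof (induction rule: shuffle_order_induct)
    case empty
    have "commutator (u z) (e_on lt {} k) = 0" for k
      by (cases "k = 0") (auto simp: commutator_def)
    then show ?case by (simp add: commutator_sum_def)
  next
    case (insert y B)
    show ?case
    proof (intro impI)
      assume less: "\<forall>x\<in>insert y B. lt x z"
      let ?A = "insert y B"
      have IH: "commutator (u z) (e_on lt B k) - commutator_sum z B * e_on lt B (k - 1) \<in> I" for k
        using insert.IH less by auto
      have commutator_sum: "commutator_sum z ?A = commutator (u z) (u y) + commutator_sum z B"
        using insert by (simp add: commutator_sum_def)
      \<comment> \<open>\<open>y\<close> lies strictly between every letter of \<open>B\<close> and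
        \<open>z\<close>, so it kills this sum from both sides, whatever its colour.\<close>
      have 1: "u y * commutator_sum z B \<in> I"
        using insert z less by (intro times_commutator_sum_mem) auto
      have 2: "commutator_sum z B * u y \<in> I"
        using insert z less by (intro commutator_sum_times_mem) auto
      show "\<forall>k. commutator (u z) (e_on lt ?A k) - commutator_sum z ?A * e_on lt ?A (k - 1) \<in> I"
      proof (cases "is_barred y")
        case False
        \<comment> \<open>The new summand \<open>[u z, u y]\<close> is killed by \<open>y\<close> as
          well, but on one side only: on the right if \<open>y\<close> is unbarred, on the left if
          it is barred.\<close>
        have 3: "commutator_sum z ?A * u y \<in> I"
          using insert z less False by (intro commutator_sum_times_mem) auto
        have rec: "e_on lt ?A k = e_on lt B k + u y * e_on lt B (k - 1)" for k
          using insert False by (intro e_on_insert_unbarred) auto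
        show ?thesis
        proof
          fix k
          have "commutator (u z) (e_on lt ?A k) - commutator_sum z ?A * e_on lt ?A (k - 1) =
              (commutator (u z) (e_on lt B k) - commutator_sum z B * e_on lt B (k - 1))
              + u y * (commutator (u z) (e_on lt B (k - 1)) - commutator_sum z B * e_on lt B (k - 1 - 1))
              + (u y * commutator_sum z B) * e_on lt B (k - 1 - 1) - (commutator_sum z ?A * u y) * e_on lt B (k - 1 - 1)"
            unfolding rec commutator_sum commutator_def by (simp add: algebra_simps)
          also have "\<dots> \<in> I"
            by (rule IH IH[THEN lmult_mem] 1[THEN rmult_mem] 3[THEN rmult_mem] | rule add_mem diff_mem)+
          finally show "commutator (u z) (e_on lt ?A k) - commutator_sum z ?A * e_on lt ?A (k - 1) \<in> I" .
        qed
      next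
        case True
        have 3: "u y * commutator_sum z ?A \<in> I"
          using insert z less True by (intro times_commutator_sum_mem) auto
        have rec: "e_on lt ?A k = e_on lt B k + u y * e_on lt ?A (k - 1)" for k
          using insert True by (intro e_on_insert_barred) auto
        \<comment> \<open>The recursion for a barred letter mentions \<open>?A\<close> again in
          lower degree, which calls for an inner induction on the degree. It starts at degree -1,
          where everything vanishes.\<close>
        have "commutator (u z) (e_on lt ?A (int n - 1)) - commutator_sum z ?A * e_on lt ?A (int n - 1 - 1) \<in> I" for n
        proof (induction n)
          case 0
          then show ?case by (simp add: commutator_def)
        next
          case (Suc n)
          define k where "k = int n"
          have k: "int (Suc n) - 1 = k" by (simp add: k_def)
          have e1: "e_on lt B (k - 1) = e_on lt ?A (k - 1) - u y * e_on lt ?A (k - 1 - 1)"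
            using rec[of "k - 1"] by simp
          have "commutator (u z) (e_on lt ?A k) - commutator_sum z ?A * e_on lt ?A (k - 1) =
              commutator (u z) (e_on lt B k) + commutator (u z) (u y) * e_on lt ?A (k - 1)
              + u y * commutator (u z) (e_on lt ?A (k - 1)) - commutator_sum z ?A * e_on lt ?A (k - 1)"
            unfolding rec[of k] commutator_def by (simp add: algebra_simps)
          also have "\<dots> = commutator (u z) (e_on lt B k) - commutator_sum z B * e_on lt ?A (k - 1)
              + u y * commutator (u z) (e_on lt ?A (k - 1))"
            by (simp add: commutator_sum algebra_simps)
          also have "\<dots> = (commutator (u z) (e_on lt B k) - commutator_sum z B * e_on lt B (k - 1))
              - (commutator_sum z B * u y) * e_on lt ?A (k - 1 - 1)
              + u y * (commutator (u z) (e_on lt ?A (k - 1)) - commutator_sum z ?A * e_on lt ?A (k - 1 - 1))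
              + (u y * commutator_sum z ?A) * e_on lt ?A (k - 1 - 1)"
            unfolding e1 by (simp only: algebra_simps)
          also have "\<dots> \<in> I"
            using Suc.IH[folded k_def]
            by - (rule IH 2[THEN rmult_mem] 3[THEN rmult_mem] | erule lmult_mem | rule add_mem diff_mem)+
          finally show ?case unfolding k .
        qed
        then have *: "commutator (u z) (e_on lt ?A k) - commutator_sum z ?A * e_on lt ?A (k - 1) \<in> I" if "k \<ge> -1" for k
          using that spec[of "\<lambda>n. commutator (u z) (e_on lt ?A (int n - 1)) - commutator_sum z ?A * e_on lt ?A (int n - 1 - 1) \<in> I" "nat (k + 1)"]
          by simp
        show ?thesis
        proof
          fix k show "commutator (u z) (e_on lt ?A k) - commutator_sum z ?A * e_on lt ?A (k - 1) \<in> I"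
            using * by (cases "k \<ge> -1") (auto simp: commutator_def)
        qed
      qed
    qed
  qed
  then show ?thesis using z by blast
qed

text \<open>For a new largest letter \<open>z\<close>, the two expansions above express a commutator
  through commutators over \<open>B\<close>, the defect in \<open>commutator_e_on\<close> and
  products of \<open>z\<close> with \<open>?D\<close>; for a barred \<open>z\<close> also through
  commutators of smaller degree.\<close>

lemma e_on_commute:
  assumes A: "finite A" "A \<subseteq> X"
  shows "commutator (e_on lt A k) (e_on lt A l) \<in> I"
proof -
  have "\<forall>k l. commutator (e_on lt A k) (e_on lt A l) \<in> I"
    using trans irrefl total A
  proof (induction rule: shuffle_order_induct)
    case empty
    have "commutator (e_on lt {} k) (e_on lt {} l) = 0" for k l
      by (cases "k = 0"; cases "l = 0") (auto simp: commutator_def)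
    then show ?case by simp
  next
    case (insert z B)
    let ?A = "insert z B"
    let ?D = "commutator_sum z B"
    define f where "f = e_on lt B"
    define e where "e = e_on lt ?A"
    define y where "y = u z"
    have IH: "commutator (f k) (f l) \<in> I" for k l
      using insert.IH by (simp add: f_def)
    have d: "commutator y (f k) - ?D * f (k - 1) \<in> I" for k
      unfolding y_def f_def using insert by (intro commutator_e_on) auto
    have "\<forall>k l. commutator (e k) (e l) \<in> I"
    proof (cases "is_barred z")
      case False
      have zD: "y * ?D \<in> I"
        unfolding y_def using insert False by (intro times_commutator_sum_mem) auto
      have rec: "e k = f k + y * f (k - 1)" for k
        unfolding e_def f_def y_def using insert False by (intro e_on_insert_unbarred) auto
      have "commutator (e k) (e l) \<in> I" for k l
      proof -
        note eq = commutator_expand_unbarred[of "f k" y "f (k - 1)" "f l" "f (l - 1)" ?D "f (k - 1 - 1)" "f (l - 1 - 1)"]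
        show ?thesis
          unfolding rec by (subst eq) (rule IH IH[THEN lmult_mem] d[THEN rmult_mem] d[THEN rmult_mem, THEN lmult_mem]
              zD[THEN rmult_mem] | rule add_mem diff_mem)+
      qed
      then show ?thesis by blast
    next
      case True
      have Dz: "?D * y \<in> I"
        unfolding y_def using insert True by (intro commutator_sum_times_mem) auto
      have rec: "f k = e k - y * e (k - 1)" for k
        unfolding e_def f_def y_def using insert True by (subst e_on_insert_barred) auto
      have neg: "commutator (e k) (e l) = 0" if "k < 0 \<or> l < 0" for k l
        using that by (auto simp: commutator_def e_def)
      have "commutator (e k) (e l) \<in> I" if "k \<ge> 0" "l \<ge> 0" for k l
        using that
      \<comment> \<open>The expansion for a barred \<open>z\<close> involves commutators over
        \<open>?A\<close> itself, so an induction on the total degree is nested inside the one on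
        letters.\<close>
      proof (induction "nat k + nat l" arbitrary: k l rule: less_induct)
        case less
        have le: "commutator (e i) (e j) \<in> I" if "i \<le> k" "j \<le> l" "i < k \<or> j < l" for i j
        proof (cases "i < 0 \<or> j < 0")
          case True
          then show ?thesis using neg by simp
        next
          case False
          then have "nat i + nat j < nat k + nat l" using that by linarith
          then show ?thesis using less.hyps False by simp
        qed
        have IHe: "commutator (e (k - 1)) (e l) \<in> I" "commutator (e k) (e (l - 1)) \<in> I"
            "commutator (e (k - 1)) (e (l - 1)) \<in> I"
          by (rule le; simp)+
        note eq = commutator_expand_barred[of "e k" "e l" y "e (k - 1)" "e (l - 1)" ?D "e (k - 1 - 1)" "e (l - 1 - 1)",
            folded rec]
        show ?case
          by (subst eq) (rule IH IHe[THEN lmult_mem] d[THEN rmult_mem] Dz[THEN rmult_mem] | rule add_mem diff_mem)+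
      qed
      then have "commutator (e k) (e l) \<in> I" for k l
        using neg[of k l] by (cases "k < 0 \<or> l < 0") auto
      then show ?thesis by blast
    qed
    then show ?case unfolding e_def by blast
  qed
  then show ?thesis by blast
qed

end

section \<open>Orthogonality and polynomials in commuting elements\<close>


lemma poly_mapping_induct_single [case_names zero single add]:
  fixes f :: "'a \<Rightarrow>\<^sub>0 'b::comm_monoid_add"
  assumes "P 0" "\<And>k v. P (Poly_Mapping.single k v)" "\<And>f g. P f \<Longrightarrow> P g \<Longrightarrow> P (f + g)"
  shows "P f"
proof (induction f rule: Poly_Mapping.update_induct)
  case const
  then show ?case using assms(1) by simp
next
  case (update f k v)
  have "Poly_Mapping.update k v f = f + Poly_Mapping.single k v"
    using update(1)
    by (intro poly_mapping_eqI) (auto simp: lookup_update lookup_add lookup_single in_keys_iff when_def)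
  then show ?case using assms update by simp
qed

section \<open>The bilinear form and the annihilator of a functional\<close>

lemma pairing_eq_sum:
  assumes "finite S" "Poly_Mapping.keys g \<subseteq> S"
  shows "pairing f g = (\<Sum>w\<in>S. Poly_Mapping.lookup f w * Poly_Mapping.lookup g w)"
proof -
  let ?h = "\<lambda>w. Poly_Mapping.lookup f w * Poly_Mapping.lookup g w"
  have "pairing f g = sum ?h (Poly_Mapping.keys f \<union> S)"
    unfolding pairing_def by (rule sum.mono_neutral_left) (use assms in \<open>auto simp: in_keys_iff\<close>)
  also have "\<dots> = sum ?h S"
    by (rule sum.mono_neutral_right) (use assms in \<open>auto simp: in_keys_iff\<close>)
  finally show ?thesis .
qed

lemma pairing_0 [simp]: "pairing 0 g = 0"
  by (simp add: pairing_def)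

lemma pairing_add: "pairing (f + g) h = pairing f h + pairing g h"
  by (simp add: pairing_eq_sum[OF finite_keys order.refl] lookup_add distrib_right sum.distrib)

lemma pairing_diff: "pairing (f - g) h = pairing f h - pairing g h"
  by (simp add: pairing_eq_sum[OF finite_keys order.refl] lookup_minus left_diff_distrib sum_subtractf)

lemma pairing_sum: "pairing (sum f S) h = (\<Sum>i\<in>S. pairing (f i) h)"
  by (induction S rule: infinite_finite_induct) (simp_all add: pairing_add)

text \<open>The annihilator is an ideal of the algebra on all letters, so that one can compute with
  the type-class ring structure of \<^typ>\<open>nc_poly\<close> instead of the ring with carrier \<^term>\<open>U N\<close>.\<close>

definition annihilator :: "nc_poly \<Rightarrow> nc_poly set" where
  "annihilator \<gamma> = {f. \<forall>a b. pairing (a * f * b) \<gamma> = 0}"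

lemma ring_ideal_annihilator: "ring_ideal (annihilator \<gamma>)"
proof
  fix a f assume f: "f \<in> annihilator \<gamma>"
  show "a * f \<in> annihilator \<gamma>"
    unfolding annihilator_def mem_Collect_eq
  proof (intro allI)
    fix b c
    show "pairing (b * (a * f) * c) \<gamma> = 0"
      using f[unfolded annihilator_def, simplified, rule_format, of "b * a" c] by (simp add: mult.assoc)
  qed
  show "f * a \<in> annihilator \<gamma>"
    unfolding annihilator_def mem_Collect_eq
  proof (intro allI)
    fix b c
    show "pairing (b * (f * a) * c) \<gamma> = 0"
      using f[unfolded annihilator_def, simplified, rule_format, of b "a * c"] by (simp add: mult.assoc)
  qed
qed (auto simp: annihilator_def pairing_add ring_distribs)

lemma pairing_annihilator: "f \<in> annihilator \<gamma> \<Longrightarrow> pairing f \<gamma> = 0"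
proof -
  assume "f \<in> annihilator \<gamma>"
  then have "pairing (1 * f * 1) \<gamma> = 0" unfolding annihilator_def by blast
  then show ?thesis by simp
qed

lemma keys_mult_single:
  fixes f :: nc_poly
  shows "Poly_Mapping.keys (Poly_Mapping.single v c * f * Poly_Mapping.single w d)
    \<subseteq> {v @ x @ w | x. x \<in> Poly_Mapping.keys f}"
proof -
  have "Poly_Mapping.keys (Poly_Mapping.single v c * f * Poly_Mapping.single w d)
      \<subseteq> {a + b | a b. a \<in> Poly_Mapping.keys (Poly_Mapping.single v c * f) \<and> b \<in> {w}}"
    using keys_mult[of "Poly_Mapping.single v c * f" "Poly_Mapping.single w d"]
    by (auto split: if_splits)
  also have "\<dots> \<subseteq> {v @ x @ w | x. x \<in> Poly_Mapping.keys f}"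
    using keys_mult[of "Poly_Mapping.single v c" f] by (auto simp: plus_list_def split: if_splits)
  finally show ?thesis .
qed

lemma plac_gens_subset: "plac_gens N lt \<subseteq> U_carrier N"
proof -
  have "word_monom v - word_monom w \<in> U_carrier N" if "set v \<subseteq> alphabet N" "set w \<subseteq> alphabet N" for v w
    using that keys_diff[of "word_monom v" "word_monom w"]
    by (fastforce simp: U_carrier_def word_monom_eq_single split: if_splits)
  then show ?thesis
    by (auto simp: plac_gens_def)
qed

lemma plac_gensI:
  "{x, y, z} \<subseteq> alphabet N \<Longrightarrow> lt x y \<Longrightarrow> lt y z \<Longrightarrow>
    word_monom [x, z, y] - word_monom [z, x, y] \<in> plac_gens N lt"
  "{x, y, z} \<subseteq> alphabet N \<Longrightarrow> lt x y \<Longrightarrow> lt y z \<Longrightarrow>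
    word_monom [y, x, z] - word_monom [y, z, x] \<in> plac_gens N lt"
  "{x, y} \<subseteq> alphabet N \<Longrightarrow> \<not> is_barred y \<Longrightarrow> lt x y \<Longrightarrow>
    word_monom [y, y, x] - word_monom [y, x, y] \<in> plac_gens N lt"
  "{y, z} \<subseteq> alphabet N \<Longrightarrow> \<not> is_barred y \<Longrightarrow> lt y z \<Longrightarrow>
    word_monom [z, y, y] - word_monom [y, z, y] \<in> plac_gens N lt"
  "{y, z} \<subseteq> alphabet N \<Longrightarrow> is_barred y \<Longrightarrow> lt y z \<Longrightarrow>
    word_monom [y, y, z] - word_monom [y, z, y] \<in> plac_gens N lt"
  "{x, y} \<subseteq> alphabet N \<Longrightarrow> is_barred y \<Longrightarrow> lt x y \<Longrightarrow>
    word_monom [x, y, y] - word_monom [y, x, y] \<in> plac_gens N lt"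
  unfolding plac_gens_def Un_iff mem_Collect_eq by blast+

text \<open>Orthogonality speaks only of products with factors over the alphabet. By bilinearity the
  factors can be taken to be multiples of single words; if one of these has a letter outside the
  alphabet, so has every word of the product, and \<open>\<gamma>\<close> vanishes on such
  words.\<close>

lemma plac_gens_annihilator:
  assumes \<gamma>: "\<gamma> \<in> orth_compl N (plac_ideal N lt)" and g: "g \<in> plac_gens N lt"
  shows "g \<in> annihilator \<gamma>"
proof -
  interpret U: ring "U N" by (rule ring_U)
  have gU: "g \<in> carrier (U N)"
    using g plac_gens_subset by (auto simp: U_def)
  have ideal: "ideal (plac_ideal N lt) (U N)"
    unfolding plac_ideal_def using plac_gens_subset by (intro U.genideal_ideal) (simp add: U_def)
  have g_in: "g \<in> plac_ideal N lt"
    unfolding plac_ideal_def genideal_def using g by auto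
  have \<gamma>_keys: "Poly_Mapping.keys \<gamma> \<subseteq> lists (alphabet N)"
    using \<gamma> by (simp add: orth_compl_def U_def U_carrier_def)
  have mono: "pairing (Poly_Mapping.single v c * g * Poly_Mapping.single w d) \<gamma> = 0" for v c w d
  proof (cases "v \<in> lists (alphabet N) \<and> w \<in> lists (alphabet N)")
    case True
    then have "Poly_Mapping.single v c \<in> carrier (U N)" "Poly_Mapping.single w d \<in> carrier (U N)"
      by (auto simp: U_def U_carrier_def)
    then have "Poly_Mapping.single v c \<otimes>\<^bsub>U N\<^esub> g \<otimes>\<^bsub>U N\<^esub> Poly_Mapping.single w d \<in> plac_ideal N lt"
      using ideal g_in by (intro ideal.I_r_closed ideal.I_l_closed)
    then show ?thesis
      using \<gamma> by (simp add: orth_compl_def) (simp add: U_def)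
  next
    case False
    have "Poly_Mapping.lookup \<gamma> x = 0"
      if x: "x \<in> Poly_Mapping.keys (Poly_Mapping.single v c * g * Poly_Mapping.single w d)" for x
    proof -
      obtain y where "x = v @ y @ w" using x keys_mult_single[of v c g w d] by blast
      then have "x \<notin> lists (alphabet N)" using False by auto
      then show ?thesis using \<gamma>_keys by (auto simp: in_keys_iff)
    qed
    then show ?thesis
      unfolding pairing_def by (intro sum.neutral) simp
  qed
  have "pairing (a * g * b) \<gamma> = 0" for a b
  proof (induction a rule: poly_mapping_induct_single)
    case (single v c)
    show ?case
    proof (induction b rule: poly_mapping_induct_single)
      case (single w d)
      then show ?case by (rule mono)
    qed (simp_all add: distrib_left pairing_add)
  qed (simp_all add: distrib_right pairing_add)
  then show ?thesis by (simp add: annihilator_def)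
qed

lemma plactic_ideal_annihilator:
  assumes lt: "shuffle_order N lt" and \<gamma>: "\<gamma> \<in> orth_compl N (plac_ideal N lt)"
  shows "plactic_ideal (annihilator \<gamma>) (alphabet N) lt"
proof -
  interpret ring_ideal "annihilator \<gamma>" by (rule ring_ideal_annihilator)
  have gen: "word_monom v - word_monom w \<in> annihilator \<gamma>"
    if "word_monom v - word_monom w \<in> plac_gens N lt \<or> word_monom w - word_monom v \<in> plac_gens N lt" for v w
    using that plac_gens_annihilator[OF \<gamma>] diff_sym by blast
  have u: "u a * u b * u c = word_monom [a, b, c]" for a b c
    by (simp add: word_monom_def mult.assoc)
  show ?thesis
  proof
    fix x y z assume xyz: "{x, y, z} \<subseteq> alphabet N"
      "lt x y \<and> lt y z \<or> lt x z \<and> y = x \<and> \<not> is_barred y \<or> lt x z \<and> y = z \<and> is_barred y"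
    have "commutator (u z) (u x) * u y = word_monom [z, x, y] - word_monom [x, z, y]"
      by (simp add: commutator_def left_diff_distrib u)
    also have "\<dots> \<in> annihilator \<gamma>"
      using xyz by (intro gen) (elim disjE conjE; auto intro: plac_gensI)
    finally show "commutator (u z) (u x) * u y \<in> annihilator \<gamma>" .
  next
    fix x y z assume xyz: "{x, y, z} \<subseteq> alphabet N"
      "lt x y \<and> lt y z \<or> lt x z \<and> y = z \<and> \<not> is_barred y \<or> lt x z \<and> y = x \<and> is_barred y"
    have "u y * commutator (u z) (u x) = word_monom [y, z, x] - word_monom [y, x, z]"
      by (simp add: commutator_def right_diff_distrib u flip: mult.assoc)
    also have "\<dots> \<in> annihilator \<gamma>"
      using xyz by (intro gen) (elim disjE conjE; auto intro: plac_gensI)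
    finally show "u y * commutator (u z) (u x) \<in> annihilator \<gamma>" .
  qed (use lt in \<open>auto simp: shuffle_order_def\<close>)
qed

section \<open>Polynomials evaluated at elements that commute modulo an ideal\<close>

locale commuting_family = ring_ideal I for I :: "'a::ring_1 set" +
  fixes e :: "nat \<Rightarrow> 'a"
  assumes commute: "commutator (e i) (e j) \<in> I"
begin

lemma commute_prod_list: "prod_list (map e xs) * e x - e x * prod_list (map e xs) \<in> I"
proof (induction xs)
  case (Cons y xs)
  have "prod_list (map e (y # xs)) * e x - e x * prod_list (map e (y # xs)) =
      e y * (prod_list (map e xs) * e x - e x * prod_list (map e xs))
      + commutator (e y) (e x) * prod_list (map e xs)"
    by (simp add: commutator_def algebra_simps)
  then show ?case
    using Cons commute by (auto intro!: add_mem intro: lmult_mem rmult_mem)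
qed simp

text \<open>The head of \<open>xs\<close> occurs in \<open>ys\<close>. Moving it to the front past
  the prefix \<open>as\<close> costs an element of the ideal, and the induction hypothesis compares
  the rest.\<close>

lemma prod_list_mset_cong:
  "mset xs = mset ys \<Longrightarrow> prod_list (map e xs) - prod_list (map e ys) \<in> I"
proof (induction xs arbitrary: ys)
  case (Cons x xs)
  have "x \<in> set ys" using Cons.prems by (metis list.set_intros(1) set_mset_mset)
  then obtain as bs where ys: "ys = as @ x # bs" by (meson split_list)
  have "mset xs = mset (as @ bs)" using Cons.prems ys by simp
  then have "prod_list (map e xs) - prod_list (map e (as @ bs)) \<in> I" by (rule Cons.IH)
  then have "e x * (prod_list (map e xs) - prod_list (map e (as @ bs)))
      - (prod_list (map e as) * e x - e x * prod_list (map e as)) * prod_list (map e bs) \<in> I"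
    by (intro diff_mem lmult_mem[OF \<open>_ \<in> I\<close>] rmult_mem[OF commute_prod_list])
  then show ?case by (simp add: ys algebra_simps)
qed simp

text \<open>Polynomials in commuting variables \<open>E\<^sub>i\<close> are represented with multisets of indices as monomials;
  \<open>ev\<close> substitutes \<open>e i\<close> for \<open>E\<^sub>i\<close> and is multiplicative only modulo \<open>I\<close>.\<close>

definition monom_ev :: "nat multiset \<Rightarrow> 'a" where
  "monom_ev M = prod_list (map e (sorted_list_of_multiset M))"

definition ev :: "(nat multiset \<Rightarrow>\<^sub>0 int) \<Rightarrow> 'a" where
  "ev F = (\<Sum>M\<in>Poly_Mapping.keys F. of_int (Poly_Mapping.lookup F M) * monom_ev M)"

lemma ev_eq_sum:
  assumes "finite S" "Poly_Mapping.keys F \<subseteq> S"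
  shows "ev F = (\<Sum>M\<in>S. of_int (Poly_Mapping.lookup F M) * monom_ev M)"
  unfolding ev_def by (rule sum.mono_neutral_left) (use assms in \<open>auto simp: in_keys_iff\<close>)

lemma ev_0 [simp]: "ev 0 = 0"
  by (simp add: ev_def)

lemma ev_add: "ev (F + G) = ev F + ev G"
proof -
  let ?S = "Poly_Mapping.keys F \<union> Poly_Mapping.keys G"
  have "Poly_Mapping.keys (F + G) \<subseteq> ?S" by (rule Poly_Mapping.keys_add)
  then show ?thesis
    using ev_eq_sum[of ?S "F + G"] ev_eq_sum[of ?S F] ev_eq_sum[of ?S G]
    by (simp add: lookup_add distrib_right sum.distrib)
qed

lemma ev_single: "ev (Poly_Mapping.single M c) = of_int c * monom_ev M"
  by (simp add: ev_def)

lemma ev_1 [simp]: "ev 1 = 1"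
  using ev_single[of "{#}" 1] by (simp add: monom_ev_def zero_multiset_def[symmetric])

lemma monom_ev_add: "monom_ev M * monom_ev M' - monom_ev (M + M') \<in> I"
  using prod_list_mset_cong[of "sorted_list_of_multiset M @ sorted_list_of_multiset M'"
      "sorted_list_of_multiset (M + M')"]
  by (simp add: monom_ev_def)

text \<open>By bilinearity it suffices to treat monomials, where both sides multiply the same
  factors in different orders.\<close>

lemma ev_mult: "ev F * ev G - ev (F * G) \<in> I"
proof (induction F rule: poly_mapping_induct_single)
  case (single M c)
  show ?case
  proof (induction G rule: poly_mapping_induct_single)
    case (single M' d)
    have "ev (Poly_Mapping.single M c) * ev (Poly_Mapping.single M' d)
        - ev (Poly_Mapping.single M c * Poly_Mapping.single M' d)
        = of_int (c * d) * (monom_ev M * monom_ev M' - monom_ev (M + M'))"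
      by (simp add: ev_single mult_single right_diff_distrib mult.assoc)
        (metis mult.assoc mult_of_int_commute)
    then show ?case using monom_ev_add lmult_mem by metis
  next
    case (add G G')
    have "ev (Poly_Mapping.single M c) * ev (G + G') - ev (Poly_Mapping.single M c * (G + G')) =
        (ev (Poly_Mapping.single M c) * ev G - ev (Poly_Mapping.single M c * G)) +
        (ev (Poly_Mapping.single M c) * ev G' - ev (Poly_Mapping.single M c * G'))"
      by (simp add: ev_add distrib_left)
    then show ?case using add add_mem by metis
  qed simp
next
  case (add F F')
  have "ev (F + F') * ev G - ev ((F + F') * G) =
      (ev F * ev G - ev (F * G)) + (ev F' * ev G - ev (F' * G))"
    by (simp add: ev_add distrib_right)
  then show ?case using add add_mem by metis
qed simp

text \<open>A substitute for the homomorphism from polynomials to the quotient ring: the relation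
  respects sums and products although \<open>ev\<close> is not multiplicative. Identities between
  commutative polynomials thereby transfer to the noncommutative algebra.\<close>

definition represents :: "'a \<Rightarrow> (nat multiset \<Rightarrow>\<^sub>0 int) \<Rightarrow> bool" where
  "represents f F \<longleftrightarrow> f - ev F \<in> I"

lemma represents_0 [simp]: "represents 0 0" and represents_1 [simp]: "represents 1 1"
  by (simp_all add: represents_def)

lemma represents_gen: "represents (e i) (Poly_Mapping.single {#i#} 1)"
  by (simp add: represents_def ev_single monom_ev_def)

lemma represents_add: "represents f F \<Longrightarrow> represents g G \<Longrightarrow> represents (f + g) (F + G)"
  unfolding represents_def ev_add using add_mem[of "f - ev F" "g - ev G"] by (simp add: algebra_simps)

lemma represents_mult:
  assumes "represents f F" "represents g G"
  shows "represents (f * g) (F * G)"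
  using assms diff_mult[of f "ev F" g "ev G"] ev_mult[of F G] diff_trans
  unfolding represents_def by blast

lemma represents_uminus: "represents f F \<Longrightarrow> represents (- f) (- F)"
  using represents_mult[of "- 1" "- 1" f F] uminus_mem ev_add[of 1 "- 1"]
  by (simp add: represents_def eq_neg_iff_add_eq_0[symmetric] add.commute[of 1])

lemma represents_of_int: "represents (of_int c) (of_int c)"
proof -
  have *: "represents (of_nat n) (of_nat n)" for n
    by (induction n) (auto intro: represents_add)
  show ?thesis
  proof (cases c)
    case (nonneg n)
    then show ?thesis using * by simp
  next
    case (neg n)
    then show ?thesis using represents_uminus[OF *[of "Suc n"]] by simp
  qed
qed

lemma represents_sum: "(\<And>i. i \<in> S \<Longrightarrow> represents (f i) (F i)) \<Longrightarrow> represents (sum f S) (sum F S)"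
  by (induction S rule: infinite_finite_induct) (auto intro: represents_add)

lemma represents_prod_list:
  "(\<And>i. i \<in> set xs \<Longrightarrow> represents (f i) (F i)) \<Longrightarrow>
    represents (prod_list (map f xs)) (prod_list (map F xs))"
  by (induction xs) (auto intro: represents_mult)

end

section \<open>The dual Jacobi--Trudi determinant and the Pieri rule\<close>


text \<open>Leibniz formula with matrices as functions on all index pairs, so that the size
  \<open>n\<close> can vary and rows and columns can be shifted past it.\<close>

definition det_fn :: "nat \<Rightarrow> (nat \<Rightarrow> nat \<Rightarrow> 'a::comm_ring_1) \<Rightarrow> 'a" where
  "det_fn n M = (\<Sum>\<pi> | \<pi> permutes {1..n}. of_int (sign \<pi>) * (\<Prod>i=1..n. M i (\<pi> i)))"

lemma det_fn_cong:
  assumes "\<And>i j. i \<in> {1..n} \<Longrightarrow> j \<in> {1..n} \<Longrightarrow> M i j = M' i j"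
  shows "det_fn n M = det_fn n M'"
  unfolding det_fn_def
proof (intro sum.cong refl arg_cong2[of _ _ _ _ "(*)"] prod.cong)
  fix \<pi> i assume "\<pi> \<in> {\<pi>. \<pi> permutes {1..n}}" "i \<in> {1..n}"
  then show "M i (\<pi> i) = M' i (\<pi> i)"
    using assms permutes_in_image[of \<pi> "{1..n}" i] by simp
qed

lemma sign_transpose_comp:
  fixes n p q :: nat
  assumes "\<pi> permutes {1..n}" "p \<noteq> q"
  shows "sign (transpose p q \<circ> \<pi>) = - sign \<pi>"
  using sign_compose[OF permutation_swap_id permutes_imp_permutation[OF finite_atLeastAtMost assms(1)], of p q] assms(2)
  by (simp add: sign_swap_id)

lemma det_fn_transpose: "det_fn n (\<lambda>i j. M j i) = det_fn n M"
proof -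
  have "det_fn n (\<lambda>i j. M j i) =
      (\<Sum>\<pi> | \<pi> permutes {1..n}. of_int (sign (inv_into UNIV \<pi>)) * (\<Prod>i=1..n. M (inv_into UNIV \<pi> i) i))"
    unfolding det_fn_def by (rule sum_permutations_inverse)
  also have "\<dots> = det_fn n M"
    unfolding det_fn_def
  proof (intro sum.cong refl arg_cong2[of _ _ _ _ "(*)"])
    fix \<pi> assume "\<pi> \<in> {\<pi>. \<pi> permutes {1..n}}"
    then have \<pi>: "\<pi> permutes {1..n}" by simp
    show "of_int (sign (inv_into UNIV \<pi>)) = (of_int (sign \<pi>) :: 'a)"
      using \<pi> by (simp add: sign_inverse permutes_imp_permutation[OF finite_atLeastAtMost])
    show "(\<Prod>i=1..n. M (inv_into UNIV \<pi> i) i) = (\<Prod>i=1..n. M i (\<pi> i))"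
      using prod.permute[OF \<pi>, of "\<lambda>i. M (inv_into UNIV \<pi> i) i"] permutes_inverses[OF \<pi>]
      by (simp add: comp_def)
  qed
  finally show ?thesis .
qed

text \<open>Composition with the transposition pairs even with odd permutations, and paired terms
  cancel. A mere change of sign would only show that twice the determinant is zero, which is weaker
  in a general commutative ring.\<close>

lemma det_fn_eq_columns:
  assumes pq: "p \<in> {1..n}" "q \<in> {1..n}" "p \<noteq> q"
    and eq: "\<And>i. i \<in> {1..n} \<Longrightarrow> M i p = M i q"
  shows "det_fn n M = 0"
proof -
  let ?P = "{\<pi>. \<pi> permutes {1..n}}"
  let ?g = "\<lambda>\<pi>. \<Prod>i=1..n. M i (\<pi> i)"
  let ?t = "transpose p q"
  have t: "?t permutes {1..n}" using pq by (simp add: permutes_swap_id)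
  have fin: "finite ?P" by (simp add: finite_permutations)
  have "det_fn n M = (\<Sum>\<pi>\<in>{\<pi>\<in>?P. sign \<pi> = 1}. of_int (sign \<pi>) * ?g \<pi>) +
      (\<Sum>\<pi>\<in>{\<pi>\<in>?P. sign \<pi> \<noteq> 1}. of_int (sign \<pi>) * ?g \<pi>)"
    unfolding det_fn_def
    by (subst sum.union_disjoint[symmetric]) (use fin in \<open>auto intro!: sum.cong\<close>)
  also have "(\<Sum>\<pi>\<in>{\<pi>\<in>?P. sign \<pi> \<noteq> 1}. of_int (sign \<pi>) * ?g \<pi>) =
      (\<Sum>\<pi>\<in>{\<pi>\<in>?P. sign \<pi> = 1}. - (of_int (sign \<pi>) * ?g \<pi>))"
  proof (rule sum.reindex_bij_witness[of _ "\<lambda>\<pi>. ?t \<circ> \<pi>" "\<lambda>\<pi>. ?t \<circ> \<pi>"])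
    fix \<pi> assume \<pi>: "\<pi> \<in> {\<pi>\<in>?P. sign \<pi> \<noteq> 1}"
    have "?g (?t \<circ> \<pi>) = ?g \<pi>"
      by (rule prod.cong) (auto simp: transpose_def eq)
    moreover have "sign (?t \<circ> \<pi>) = - sign \<pi>" using sign_transpose_comp[of \<pi> n p q] \<pi> pq by auto
    ultimately show "- (of_int (sign (?t \<circ> \<pi>)) * ?g (?t \<circ> \<pi>)) = of_int (sign \<pi>) * ?g \<pi>" by simp
    show "?t \<circ> \<pi> \<in> {\<pi>\<in>?P. sign \<pi> = 1}"
      using \<pi> pq sign_transpose_comp[of \<pi> n p q] permutes_compose[OF _ t, of \<pi>]
      by (auto simp: sign_def split: if_splits)
  next
    fix \<pi> assume \<pi>: "\<pi> \<in> {\<pi>\<in>?P. sign \<pi> = 1}"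
    then show "?t \<circ> \<pi> \<in> {\<pi>\<in>?P. sign \<pi> \<noteq> 1}"
      using pq sign_transpose_comp[of \<pi> n p q] permutes_compose[OF _ t, of \<pi>] by auto
  qed (simp_all add: comp_assoc[symmetric])
  finally show ?thesis by (simp add: sum_negf)
qed

lemma det_fn_eq_rows:
  assumes "p \<in> {1..n}" "q \<in> {1..n}" "p \<noteq> q" "\<And>j. j \<in> {1..n} \<Longrightarrow> M p j = M q j"
  shows "det_fn n M = 0"
  unfolding det_fn_transpose[of n M, symmetric]
  by (rule det_fn_eq_columns[OF assms(1-3)]) (rule assms(4))

lemma det_fn_swap_columns:
  assumes pq: "p \<in> {1..n}" "q \<in> {1..n}" "p \<noteq> q"
  shows "det_fn n (\<lambda>i j. M i (transpose p q j)) = - det_fn n M"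
proof -
  have t: "transpose p q permutes {1..n}" using pq by (simp add: permutes_swap_id)
  have "- det_fn n M =
      - (\<Sum>\<pi> | \<pi> permutes {1..n}. of_int (sign (transpose p q \<circ> \<pi>)) *
          (\<Prod>i=1..n. M i ((transpose p q \<circ> \<pi>) i)))"
    unfolding det_fn_def by (subst setum_permutations_compose_left[OF t]) simp
  also have "\<dots> = det_fn n (\<lambda>i j. M i (transpose p q j))"
    unfolding det_fn_def sum_negf[symmetric]
    by (intro sum.cong refl) (simp add: sign_transpose_comp[OF _ pq(3)])
  finally show ?thesis by simp
qed

text \<open>A permutation meets column \<open>q\<close> in exactly one row, the preimage of
  \<open>q\<close>, so every product is linear in that column.\<close>

lemma det_fn_column_sum:
  assumes q: "q \<in> {1..n}"
  shows "det_fn n (\<lambda>i j. if j = q then \<Sum>l\<in>S. x l * V l i else M i j) =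
    (\<Sum>l\<in>S. x l * det_fn n (\<lambda>i j. if j = q then V l i else M i j))"
proof -
  have expand: "(\<Prod>i=1..n. if \<pi> i = q then A i else M i (\<pi> i)) =
      A (inv_into UNIV \<pi> q) * (\<Prod>i\<in>{1..n}-{inv_into UNIV \<pi> q}. M i (\<pi> i))"
    if \<pi>: "\<pi> permutes {1..n}" for \<pi> A
  proof -
    have "inv_into UNIV \<pi> q \<in> {1..n}" using q permutes_in_image[OF permutes_inv[OF \<pi>]] by blast
    moreover have "(\<Prod>i\<in>{1..n}-{inv_into UNIV \<pi> q}. if \<pi> i = q then A i else M i (\<pi> i)) =
        (\<Prod>i\<in>{1..n}-{inv_into UNIV \<pi> q}. M i (\<pi> i))"
      using permutes_inverses[OF \<pi>] by (intro prod.cong) auto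
    ultimately show ?thesis
      using permutes_inverses[OF \<pi>] by (subst prod.remove[of _ "inv_into UNIV \<pi> q"]) auto
  qed
  have "det_fn n (\<lambda>i j. if j = q then \<Sum>l\<in>S. x l * V l i else M i j) =
      (\<Sum>\<pi> | \<pi> permutes {1..n}. \<Sum>l\<in>S. x l *
        (of_int (sign \<pi>) * (\<Prod>i=1..n. if \<pi> i = q then V l i else M i (\<pi> i))))"
    unfolding det_fn_def
  proof (intro sum.cong refl)
    fix \<pi> assume "\<pi> \<in> {\<pi>. \<pi> permutes {1..n}}"
    then have \<pi>: "\<pi> permutes {1..n}" by simp
    show "of_int (sign \<pi>) * (\<Prod>i=1..n. if \<pi> i = q then \<Sum>l\<in>S. x l * V l i else M i (\<pi> i)) =
      (\<Sum>l\<in>S. x l * (of_int (sign \<pi>) * (\<Prod>i=1..n. if \<pi> i = q then V l i else M i (\<pi> i))))"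
      unfolding expand[OF \<pi>] sum_distrib_left sum_distrib_right
      by (intro sum.cong refl) (simp add: mult_ac)
  qed
  also have "\<dots> = (\<Sum>l\<in>S. x l * det_fn n (\<lambda>i j. if j = q then V l i else M i j))"
    unfolding det_fn_def sum_distrib_left by (rule sum.swap)
  finally show ?thesis .
qed

text \<open>Both sides are the coefficient of \<open>t^k\<close> in the determinant of
  \<open>M False + t M True\<close>. For a fixed permutation, a choice of rows is the same as the
  choice of the image columns.\<close>

lemma sum_det_fn_rows_eq_columns:
  "(\<Sum>\<epsilon> | \<epsilon> \<subseteq> {1..n} \<and> card \<epsilon> = k. det_fn n (\<lambda>i j. M (i \<in> \<epsilon>) i j)) =
   (\<Sum>\<delta> | \<delta> \<subseteq> {1..n} \<and> card \<delta> = k. det_fn n (\<lambda>i j. M (j \<in> \<delta>) i j))"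
proof -
  let ?S = "{\<epsilon>. \<epsilon> \<subseteq> {1..n} \<and> card \<epsilon> = k}"
  have *: "(\<Sum>\<epsilon>\<in>?S. \<Prod>i=1..n. M (i \<in> \<epsilon>) i (\<pi> i)) = (\<Sum>\<delta>\<in>?S. \<Prod>i=1..n. M (\<pi> i \<in> \<delta>) i (\<pi> i))"
    if \<pi>: "\<pi> permutes {1..n}" for \<pi>
  proof (rule sum.reindex_bij_witness[of _ "\<lambda>\<delta>. inv_into UNIV \<pi> ` \<delta>" "\<lambda>\<epsilon>. \<pi> ` \<epsilon>"])
    have inj: "inj \<pi>" "inj (inv_into UNIV \<pi>)"
      using permutes_inj[OF \<pi>] permutes_inj[OF permutes_inv[OF \<pi>]] by auto
    fix \<epsilon> assume \<epsilon>: "\<epsilon> \<in> ?S"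
    show "inv_into UNIV \<pi> ` \<pi> ` \<epsilon> = \<epsilon>" "\<pi> ` inv_into UNIV \<pi> ` \<epsilon> = \<epsilon>"
      using permutes_inverses[OF \<pi>] by (auto simp: image_iff)
    show "\<pi> ` \<epsilon> \<in> ?S"
      using \<epsilon> permutes_in_image[OF \<pi>] by (auto simp: card_image[OF inj_on_subset[OF inj(1)]])
    show "inv_into UNIV \<pi> ` \<epsilon> \<in> ?S"
      using \<epsilon> permutes_in_image[OF permutes_inv[OF \<pi>]]
      by (auto simp: card_image[OF inj_on_subset[OF inj(2)]])
    show "(\<Prod>i=1..n. M (\<pi> i \<in> \<pi> ` \<epsilon>) i (\<pi> i)) = (\<Prod>i=1..n. M (i \<in> \<epsilon>) i (\<pi> i))"
      by (simp add: inj_image_mem_iff[OF inj(1)])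
  qed
  have "(\<Sum>\<epsilon>\<in>?S. det_fn n (\<lambda>i j. M (i \<in> \<epsilon>) i j)) =
      (\<Sum>\<pi> | \<pi> permutes {1..n}. of_int (sign \<pi>) * (\<Sum>\<epsilon>\<in>?S. \<Prod>i=1..n. M (i \<in> \<epsilon>) i (\<pi> i)))"
    unfolding det_fn_def sum_distrib_left by (rule sum.swap)
  also have "\<dots> =
      (\<Sum>\<pi> | \<pi> permutes {1..n}. of_int (sign \<pi>) * (\<Sum>\<delta>\<in>?S. \<Prod>i=1..n. M (\<pi> i \<in> \<delta>) i (\<pi> i)))"
    by (intro sum.cong refl arg_cong[of _ _ "(*) _"] *) simp
  also have "\<dots> = (\<Sum>\<delta>\<in>?S. det_fn n (\<lambda>i j. M (j \<in> \<delta>) i j))"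
    unfolding det_fn_def sum_distrib_left by (rule sum.swap)
  finally show ?thesis .
qed

text \<open>The substitution is a cycle on the last \<open>k\<close> columns, built up by one
  transposition for each step of \<open>k\<close>.\<close>

lemma det_fn_cycle_columns:
  assumes "1 \<le> k" "k \<le> n"
  shows "det_fn n (\<lambda>i j. M i (if j = n then n + 1 - k else j + of_bool (n - k < j))) =
    (- 1) ^ (k + 1) * det_fn n M"
  using assms
proof (induction k rule: dec_induct)
  case base
  have "det_fn n (\<lambda>i j. M i (if j = n then n + 1 - 1 else j + of_bool (n - 1 < j))) = det_fn n M"
    by (rule det_fn_cong) auto
  then show ?case by simp
next
  case (step k)
  let ?c = "\<lambda>k j. if j = n then n + 1 - k else j + of_bool (n - k < j)"
  have "det_fn n (\<lambda>i j. M i (?c (Suc k) j)) = det_fn n (\<lambda>i j. M i (?c k (transpose (n - k) n j)))"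
    using step by (intro det_fn_cong arg_cong[of _ _ "M _"]) (auto simp: transpose_def)
  also have "\<dots> = - det_fn n (\<lambda>i j. M i (?c k j))"
    using step by (intro det_fn_swap_columns) auto
  finally show ?case using step by simp
qed

lemma up_closed_subset_eq:
  assumes "\<delta> \<subseteq> {1..n}" and up: "\<And>j. j \<in> \<delta> \<Longrightarrow> j < n \<Longrightarrow> Suc j \<in> \<delta>"
  shows "\<delta> = {n - card \<delta> <.. n}"
proof (cases "\<delta> = {}")
  case False
  have fin: "finite \<delta>" using assms(1) finite_subset by blast
  define m where "m = Min \<delta>"
  have m: "m \<in> \<delta>" "1 \<le> m" "m \<le> n" using assms(1) Min_in[OF fin False] by (auto simp: m_def)
  have "j \<in> \<delta>" if "m \<le> j" "j \<le> n" for j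
    using that by (induction j rule: dec_induct) (auto simp: m up)
  then have \<delta>: "\<delta> = {m..n}"
    using assms(1) Min_le[OF fin] by (auto simp: m_def)
  then have "card \<delta> = Suc n - m" by simp
  then show ?thesis using \<delta> m by auto
qed simp

section \<open>Jacobi-Trudi determinants and horizontal strips\<close>

locale elementary_complete =
  fixes E :: "int \<Rightarrow> 'a::comm_ring_1" and h :: "nat \<Rightarrow> 'a"
  assumes E_neg: "\<And>k. k < 0 \<Longrightarrow> E k = 0" and E_0: "E 0 = 1" and h_0: "h 0 = 1"
    and sum_h_E: "\<And>k. 0 < k \<Longrightarrow> (\<Sum>l\<le>k. (- 1) ^ l * h l * E (int k - int l)) = 0"
begin

text \<open>\<open>a i\<close> plays the role of the length of column \<open>i\<close> of a diagram,
  counted from 1. It is an arbitrary function because the proof of the Pieri rule passes through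
  sequences that are not nonincreasing.\<close>

definition jacobi_trudi :: "nat \<Rightarrow> (nat \<Rightarrow> nat) \<Rightarrow> 'a" where
  "jacobi_trudi n a = det_fn n (\<lambda>i j. E (int (a i) + int j - int i))"

text \<open>The last row is zero left of the diagonal and 1 on it, so only permutations fixing
  \<open>Suc n\<close> contribute.\<close>

lemma jacobi_trudi_Suc:
  assumes "a (Suc n) = 0"
  shows "jacobi_trudi (Suc n) a = jacobi_trudi n a"
proof -
  let ?f = "\<lambda>n \<pi>. of_int (sign \<pi>) * (\<Prod>i=1..n. E (int (a i) + int (\<pi> i) - int i))"
  have "sum (?f (Suc n)) {\<pi>. \<pi> permutes {1..Suc n}} = sum (?f (Suc n)) {\<pi>. \<pi> permutes {1..n}}"
  proof (rule sum.mono_neutral_right)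
    show "{\<pi>. \<pi> permutes {1..n}} \<subseteq> {\<pi>. \<pi> permutes {1..Suc n}}"
      using permutes_subset[of _ "{1..n}" "{1..Suc n}"] by auto
    show "\<forall>\<pi>\<in>{\<pi>. \<pi> permutes {1..Suc n}} - {\<pi>. \<pi> permutes {1..n}}. ?f (Suc n) \<pi> = 0"
    proof
      fix \<pi> assume \<pi>: "\<pi> \<in> {\<pi>. \<pi> permutes {1..Suc n}} - {\<pi>. \<pi> permutes {1..n}}"
      then have "\<pi> (Suc n) \<noteq> Suc n"
        using permutes_superset[of \<pi> "{1..Suc n}" "{1..n}"] by (auto simp: le_Suc_eq)
      moreover have "\<pi> (Suc n) \<in> {1..Suc n}"
        using \<pi> permutes_in_image[of \<pi> "{1..Suc n}" "Suc n"] by simp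
      ultimately have "E (int (\<pi> (Suc n)) - int (Suc n)) = 0" by (intro E_neg) auto
      then show "?f (Suc n) \<pi> = 0" using assms by simp
    qed
  qed (simp add: finite_permutations)
  also have "\<dots> = sum (?f n) {\<pi>. \<pi> permutes {1..n}}"
  proof (rule sum.cong[OF refl])
    fix \<pi> assume "\<pi> \<in> {\<pi>. \<pi> permutes {1..n}}"
    then have "\<pi> (Suc n) = Suc n" by (auto simp: permutes_def)
    then show "?f (Suc n) \<pi> = ?f n \<pi>" using assms by (simp add: E_0)
  qed
  finally show ?thesis by (simp add: jacobi_trudi_def det_fn_def)
qed

lemma jacobi_trudi_stable:
  assumes "m \<le> n" "\<And>i. m < i \<Longrightarrow> a i = 0"
  shows "jacobi_trudi n a = jacobi_trudi m a"
  using assms(1) by (induction n rule: dec_induct) (simp_all add: jacobi_trudi_Suc assms(2))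

text \<open>Expand the last column with \<open>sum_h_E\<close>. Only the term \<open>l = k\<close> survives: for every other \<open>l \<le> n\<close>
  the new column repeats an old one, and for \<open>l > n\<close> the \<open>n - p\<close> rows below \<open>p\<close>
  have only \<open>n - p - 1\<close> columns with nonzero entries.\<close>

lemma jacobi_trudi_shifted_columns:
  assumes supp: "\<And>i. p < i \<Longrightarrow> a i = 0" and n: "p + k \<le> n"
  shows "det_fn n (\<lambda>i j. E (int (a i) + int (j + of_bool (n - k < j)) - int i)) = h k * jacobi_trudi n a"
proof (cases "k = 0")
  case True
  then show ?thesis
    by (auto simp: h_0 jacobi_trudi_def intro!: det_fn_cong)
next
  case False
  define b where "b i = int (a i) - int i" for i
  define c where "c j = j + of_bool (n - k < j)" for j
  define X where "X v = det_fn n (\<lambda>i j. if j = n then E (b i + v) else E (b i + int (c j)))" for v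
  \<comment> \<open>An upper bound for all indices \<open>b i + n + 1\<close> in the last column, so
    that one range of \<open>l\<close> serves every row; the extra terms have negative
    index.\<close>
  define L where "L = (\<Sum>i=1..n. a i) + n + 1"
  have "n \<ge> 1" using False n by simp
  have expand: "E (b i + int n + 1) = (\<Sum>l=1..L. (- 1) ^ (l + 1) * h l * E (b i + (int n + 1 - int l)))"
    if i: "i \<in> {1..n}" for i
  proof -
    define K where "K = nat (b i + int n + 1)"
    have K: "int K = b i + int n + 1" "K > 0" using i by (auto simp: K_def b_def)
    have "a i \<le> (\<Sum>i=1..n. a i)" using i by (intro member_le_sum) auto
    then have "K \<le> L" using i by (auto simp: K_def L_def b_def)
    then have "(\<Sum>l\<le>K. (- 1) ^ l * h l * E (int K - int l)) = (\<Sum>l\<le>L. (- 1) ^ l * h l * E (int K - int l))"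
      by (intro sum.mono_neutral_left) (simp_all add: E_neg)
    then have "0 = (\<Sum>l\<le>L. (- 1) ^ l * h l * E (int K - int l))"
      using sum_h_E[OF K(2)] by simp
    also have "\<dots> = E (int K) + (\<Sum>l=1..L. (- 1) ^ l * h l * E (int K - int l))"
      unfolding atMost_atLeast0 by (subst sum.atLeast_Suc_atMost) (simp_all add: h_0)
    finally have "E (int K) = - (\<Sum>l=1..L. (- 1) ^ l * h l * E (int K - int l))"
      by (simp add: eq_neg_iff_add_eq_0)
    also have "\<dots> = (\<Sum>l=1..L. (- 1) ^ (l + 1) * h l * E (int K - int l))"
      by (simp add: sum_negf[symmetric])
    finally show ?thesis by (simp add: K(1) add_diff_eq add.assoc)
  qed
  have "det_fn n (\<lambda>i j. E (int (a i) + int (j + of_bool (n - k < j)) - int i)) =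
      det_fn n (\<lambda>i j. if j = n then \<Sum>l=1..L. ((- 1) ^ (l + 1) * h l) * E (b i + (int n + 1 - int l))
        else E (b i + int (c j)))"
  proof (rule det_fn_cong)
    fix i j assume ij: "i \<in> {1..n}" "j \<in> {1..n}"
    show "E (int (a i) + int (j + of_bool (n - k < j)) - int i) =
      (if j = n then \<Sum>l=1..L. ((- 1) ^ (l + 1) * h l) * E (b i + (int n + 1 - int l))
        else E (b i + int (c j)))"
      using expand[OF ij(1)] False ij(2) by (auto simp: b_def c_def algebra_simps)
  qed
  also have "\<dots> = (\<Sum>l=1..L. (- 1) ^ (l + 1) * h l * X (int n + 1 - int l))"
    unfolding X_def using \<open>n \<ge> 1\<close> by (subst det_fn_column_sum) auto
  also have "\<dots> = (\<Sum>l\<in>{k}. (- 1) ^ (l + 1) * h l * X (int n + 1 - int l))"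
  proof (rule sum.mono_neutral_right)
    show "{k} \<subseteq> {1..L}" using n False by (auto simp: L_def)
    show "\<forall>l\<in>{1..L} - {k}. (- 1) ^ (l + 1) * h l * X (int n + 1 - int l) = 0"
    proof
      fix l assume l: "l \<in> {1..L} - {k}"
      have "X (int n + 1 - int l) = 0"
      proof (cases "l \<le> n")
        case True
        \<comment> \<open>Apart from the last column, the indices \<open>c j\<close> run through 1
          to \<open>n\<close> without \<open>n + 1 - k\<close>. This \<open>j\<close> is the column
          with index \<open>n + 1 - l\<close>, which exists because \<open>l\<close> differs from
          \<open>k\<close>.\<close>
        define j where "j = (if k < l then n + 1 - l else n - l)"
        have j: "j \<in> {1..n}" "j \<noteq> n" "int (c j) = int n + 1 - int l"
          using l True n False by (auto simp: j_def c_def)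
        show ?thesis
          unfolding X_def by (rule det_fn_eq_columns[of j _ n]) (use j in auto)
      next
        case False
        define v where "v = int n + 1 - int l"
        have v: "v \<le> 0" using False by (simp add: v_def)
        have "(\<Prod>i=1..n. if \<pi> i = n then E (b i + v) else E (b i + int (c (\<pi> i)))) = 0"
          if \<pi>: "\<pi> permutes {1..n}" for \<pi>
        proof -
          have "\<exists>i\<in>{p+1..n}. \<pi> i = n \<or> c (\<pi> i) < i"
          proof (rule ccontr)
            assume "\<not> ?thesis"
            then have *: "\<pi> i \<noteq> n" "i \<le> c (\<pi> i)" if "i \<in> {p+1..n}" for i using that by (auto simp: not_less)
            have "\<pi> ` {p+1..n} \<subseteq> {p+1..n-1}"
            proof safe
              fix i assume i: "i \<in> {p+1..n}"
              then have "\<pi> i \<in> {1..n}" using permutes_in_image[OF \<pi>, of i] by simp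
              moreover have "p + 1 \<le> \<pi> i"
                using *(2)[OF i] i n by (cases "n - k < \<pi> i") (auto simp: c_def)
              ultimately show "\<pi> i \<in> {p+1..n-1}" using *(1)[OF i] by auto
            qed
            then have "card (\<pi> ` {p+1..n}) \<le> card {p+1..n-1}" by (intro card_mono) auto
            moreover have "card (\<pi> ` {p+1..n}) = card {p+1..n}"
              by (rule card_image[OF inj_on_subset[OF permutes_inj[OF \<pi>]]]) simp
            ultimately show False using n \<open>k \<noteq> 0\<close> by simp
          qed
          then obtain i where i: "i \<in> {p+1..n}" "\<pi> i = n \<or> c (\<pi> i) < i" by blast
          then have "b i = - int i" using supp[of i] by (simp add: b_def)
          then have "(if \<pi> i = n then E (b i + v) else E (b i + int (c (\<pi> i)))) = 0"
            using i v by (cases "\<pi> i = n") (auto intro!: E_neg)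
          then show ?thesis using i(1) by (intro prod_zero bexI[of _ i]) auto
        qed
        then show ?thesis unfolding X_def det_fn_def v_def[symmetric] by (intro sum.neutral) simp
      qed
      then show "(- 1) ^ (l + 1) * h l * X (int n + 1 - int l) = 0" by simp
    qed
  qed simp
  also have "\<dots> = (- 1) ^ (k + 1) * h k * X (int n + 1 - int k)" by simp
  \<comment> \<open>The surviving term puts the missing index \<open>n + 1 - k\<close> into the last
    column. The columns are now those of the unshifted determinant up to a cycle, whose sign cancels
    the one from the expansion.\<close>
  also have "X (int n + 1 - int k) =
      det_fn n (\<lambda>i j. E (b i + int (if j = n then n + 1 - k else j + of_bool (n - k < j))))"
    unfolding X_def using n by (intro det_fn_cong) (auto simp: c_def of_nat_diff algebra_simps)
  also have "\<dots> = (- 1) ^ (k + 1) * det_fn n (\<lambda>i j. E (b i + int j))"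
    using n False by (intro det_fn_cycle_columns[of k n "\<lambda>i j. E (b i + int j)"]) auto
  also have "det_fn n (\<lambda>i j. E (b i + int j)) = jacobi_trudi n a"
    unfolding jacobi_trudi_def by (rule det_fn_cong) (simp add: b_def algebra_simps)
  finally have "det_fn n (\<lambda>i j. E (int (a i) + int (j + of_bool (n - k < j)) - int i)) =
      ((- 1) ^ (k + 1) * (- 1) ^ (k + 1)) * (h k * jacobi_trudi n a)"
    by (simp add: mult_ac)
  also have "(- 1) ^ (k + 1) * (- 1) ^ (k + 1) = (1::'a)"
    by (simp flip: power_mult_distrib)
  finally show ?thesis by simp
qed

text \<open>Incrementing \<open>k\<close> rows in all ways amounts to incrementing \<open>k\<close> columns in all ways. Repeated
  rows cancel all but the horizontal strips, repeated columns all but the last \<open>k\<close> columns.\<close>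

lemma pieri:
  assumes anti: "antimono (\<lambda>c. a (Suc c))" and supp: "\<And>i. p < i \<Longrightarrow> a i = 0" and n: "p + k \<le> n"
  shows "h k * jacobi_trudi n a =
    (\<Sum>\<epsilon> | \<epsilon> \<subseteq> {1..n} \<and> card \<epsilon> = k \<and> antimono (\<lambda>c. a (Suc c) + of_bool (Suc c \<in> \<epsilon>)).
      jacobi_trudi n (\<lambda>i. a i + of_bool (i \<in> \<epsilon>)))"
proof -
  let ?S = "{\<epsilon>. \<epsilon> \<subseteq> {1..n} \<and> card \<epsilon> = k}"
  define M where "M \<beta> i j = E (int (a i) + of_bool \<beta> + int j - int i)" for \<beta> i j
  have fin: "finite ?S" by (rule finite_subset[of _ "Pow {1..n}"]) auto
  have "(\<Sum>\<epsilon> | \<epsilon> \<subseteq> {1..n} \<and> card \<epsilon> = k \<and> antimono (\<lambda>c. a (Suc c) + of_bool (Suc c \<in> \<epsilon>)).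
      jacobi_trudi n (\<lambda>i. a i + of_bool (i \<in> \<epsilon>))) =
      (\<Sum>\<epsilon>\<in>?S. jacobi_trudi n (\<lambda>i. a i + of_bool (i \<in> \<epsilon>)))"
  proof (rule sum.mono_neutral_left)
    show "\<forall>\<epsilon>\<in>?S - {\<epsilon>. \<epsilon> \<subseteq> {1..n} \<and> card \<epsilon> = k \<and> antimono (\<lambda>c. a (Suc c) + of_bool (Suc c \<in> \<epsilon>))}.
        jacobi_trudi n (\<lambda>i. a i + of_bool (i \<in> \<epsilon>)) = 0"
    proof
      fix \<epsilon> assume \<epsilon>: "\<epsilon> \<in> ?S - {\<epsilon>. \<epsilon> \<subseteq> {1..n} \<and> card \<epsilon> = k \<and> antimono (\<lambda>c. a (Suc c) + of_bool (Suc c \<in> \<epsilon>))}"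
      then obtain c where "\<not> a (Suc (Suc c)) + of_bool (Suc (Suc c) \<in> \<epsilon>) \<le> a (Suc c) + of_bool (Suc c \<in> \<epsilon>)"
        by (auto simp: antimono_iff_le_Suc)
      moreover have "a (Suc (Suc c)) \<le> a (Suc c)" using anti by (simp add: antimono_iff_le_Suc)
      \<comment> \<open>The new cell makes up for the difference of the row numbers: both rows now
        have the same value of \<open>a\<close> plus increment minus row number, hence the same
        entries.\<close>
      ultimately have c: "a (Suc (Suc c)) = a (Suc c)" "Suc c \<notin> \<epsilon>" "Suc (Suc c) \<in> \<epsilon>"
        by (auto split: if_splits simp: of_bool_def)
      show "jacobi_trudi n (\<lambda>i. a i + of_bool (i \<in> \<epsilon>)) = 0"
        unfolding jacobi_trudi_def
        by (rule det_fn_eq_rows[of "Suc c" _ "Suc (Suc c)"]) (use c \<epsilon> in \<open>auto simp: algebra_simps\<close>)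
    qed
  qed (use fin in auto)
  also have "\<dots> = (\<Sum>\<epsilon>\<in>?S. det_fn n (\<lambda>i j. M (i \<in> \<epsilon>) i j))"
    by (simp add: jacobi_trudi_def M_def)
  also have "\<dots> = (\<Sum>\<delta>\<in>?S. det_fn n (\<lambda>i j. M (j \<in> \<delta>) i j))"
    by (rule sum_det_fn_rows_eq_columns)
  also have "\<dots> = (\<Sum>\<delta>\<in>{{n-k<..n}}. det_fn n (\<lambda>i j. M (j \<in> \<delta>) i j))"
  proof (rule sum.mono_neutral_right)
    show "\<forall>\<delta>\<in>?S - {{n-k<..n}}. det_fn n (\<lambda>i j. M (j \<in> \<delta>) i j) = 0"
    proof
      fix \<delta> assume \<delta>: "\<delta> \<in> ?S - {{n-k<..n}}"
      \<comment> \<open>Column \<open>j\<close> with its increment coincides with column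
        \<open>Suc j\<close> without one.\<close>
      then obtain j where j: "j \<in> \<delta>" "j < n" "Suc j \<notin> \<delta>"
        using up_closed_subset_eq[of \<delta> n] by auto
      then show "det_fn n (\<lambda>i j. M (j \<in> \<delta>) i j) = 0"
        using \<delta> by (intro det_fn_eq_columns[of j _ "Suc j"]) (auto simp: M_def algebra_simps)
    qed
  qed (use fin n in auto)
  also have "\<dots> = det_fn n (\<lambda>i j. E (int (a i) + int (j + of_bool (n - k < j)) - int i))"
    by (auto simp: M_def algebra_simps intro!: det_fn_cong)
  also have "\<dots> = h k * jacobi_trudi n a"
    using supp n by (rule jacobi_trudi_shifted_columns)
  finally show ?thesis by simp
qed

end

section \<open>Removing the largest entries of a tableau\<close>


text \<open>All copies of the largest element go at once, because one factor \<open>h k\<close>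
  accounts for \<open>k\<close> equal entries together.\<close>

lemma multiset_max_block_induct [case_names empty block]:
  fixes m :: "'a::linorder multiset"
  assumes "P {#}"
    and block: "\<And>m M k. (\<And>x. x \<in># m \<Longrightarrow> x < M) \<Longrightarrow> 0 < k \<Longrightarrow> P m \<Longrightarrow> P (m + replicate_mset k M)"
  shows "P m"
proof (induction "size m" arbitrary: m rule: less_induct)
  case less
  show ?case
  proof (cases "m = {#}")
    case False
    define M where "M = Max_mset m"
    define m' where "m' = filter_mset (\<lambda>x. x \<noteq> M) m"
    have M: "M \<in># m" using False by (simp add: M_def)
    have m: "m = m' + replicate_mset (count m M) M"
      unfolding m'_def by (rule multiset_eqI) auto
    have "count m M > 0" using M by simp
    moreover have "x < M" if "x \<in># m'" for x
      using that by (auto simp: m'_def M_def order_less_le)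
    moreover have "size m = size m' + count m M" by (subst m) (simp only: size_union size_replicate_mset)
    ultimately have "P (m' + replicate_mset (count m M) M)" by (intro block less) simp_all
    then show ?thesis using m by simp
  qed (use assms(1) in simp)
qed

lemma down_closed_eq_lessThan:
  fixes S :: "nat set"
  assumes fin: "finite S" and down: "\<And>i j. j \<in> S \<Longrightarrow> i < j \<Longrightarrow> i \<in> S"
  shows "S = {..<card S}"
proof (cases "S = {}")
  case False
  have "Max S \<in> S" using fin False by simp
  then have "S = {..Max S}"
    using Max_ge[OF fin] down by (auto simp: order_le_less)
  then have "card S = Suc (Max S)" by (metis card_atMost)
  then show ?thesis using \<open>S = {..Max S}\<close> by (simp add: lessThan_Suc_atMost)
qed simp

text \<open>A tableau is determined by its filling, since the diagram is the set of nonzero entries.\<close>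

definition supp :: "(nat \<times> nat \<Rightarrow> nat) \<Rightarrow> (nat \<times> nat) set" where
  "supp T = {p. T p \<noteq> 0}"

definition tableau :: "(nat \<times> nat \<Rightarrow> nat) \<Rightarrow> bool" where
  "tableau T \<longleftrightarrow> finite (supp T) \<and>
     (\<forall>r c c'. T (r, c') \<noteq> 0 \<and> c < c' \<longrightarrow> T (r, c) \<noteq> 0 \<and> T (r, c) \<le> T (r, c')) \<and>
     (\<forall>r r' c. T (r', c) \<noteq> 0 \<and> r < r' \<longrightarrow> T (r, c) \<noteq> 0 \<and> T (r, c) < T (r', c))"

definition tableaux :: "nat multiset \<Rightarrow> (nat \<times> nat \<Rightarrow> nat) set" where
  "tableaux m = {T. tableau T \<and> image_mset T (mset_set (supp T)) = m}"

text \<open>Columns are counted from \<open>1\<close>, to match \<open>conj_part\<close>.\<close>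

definition col_len :: "(nat \<times> nat \<Rightarrow> nat) \<Rightarrow> nat \<Rightarrow> nat" where
  "col_len T i = (if i = 0 then 0 else card {r. T (r, i - 1) \<noteq> 0})"

lemma tableau_row:
  "tableau T \<Longrightarrow> T (r, c') \<noteq> 0 \<Longrightarrow> c < c' \<Longrightarrow> T (r, c) \<noteq> 0 \<and> T (r, c) \<le> T (r, c')"
  unfolding tableau_def by blast

lemma tableau_column:
  "tableau T \<Longrightarrow> T (r', c) \<noteq> 0 \<Longrightarrow> r < r' \<Longrightarrow> T (r, c) \<noteq> 0 \<and> T (r, c) < T (r', c)"
  unfolding tableau_def by blast

lemma finite_column: "finite (supp T) \<Longrightarrow> finite {r. T (r, c) \<noteq> 0}"
  by (rule finite_surj[of "supp T" _ fst]) (force simp: supp_def)+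

lemma finite_row: "finite (supp T) \<Longrightarrow> finite {c. T (r, c) \<noteq> 0}"
  by (rule finite_surj[of "supp T" _ snd]) (force simp: supp_def)+

lemma nonzero_iff_less_col_len:
  assumes "tableau T"
  shows "T (r, c) \<noteq> 0 \<longleftrightarrow> r < col_len T (Suc c)"
proof -
  have "{r. T (r, c) \<noteq> 0} = {..<card {r. T (r, c) \<noteq> 0}}"
  proof (rule down_closed_eq_lessThan)
    show "finite {r. T (r, c) \<noteq> 0}"
      using assms by (intro finite_column) (simp add: tableau_def)
  qed (use tableau_column[OF assms] in blast)
  then show ?thesis by (auto simp: col_len_def)
qed

lemma nonzero_iff_less_row_len:
  assumes "tableau T"
  shows "T (r, c) \<noteq> 0 \<longleftrightarrow> c < card {c. T (r, c) \<noteq> 0}"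
proof -
  have "{c. T (r, c) \<noteq> 0} = {..<card {c. T (r, c) \<noteq> 0}}"
  proof (rule down_closed_eq_lessThan)
    show "finite {c. T (r, c) \<noteq> 0}"
      using assms by (intro finite_row) (simp add: tableau_def)
  qed (use tableau_row[OF assms] in blast)
  then show ?thesis by auto
qed

lemma antimono_col_len:
  assumes "tableau T"
  shows "antimono (\<lambda>c. col_len T (Suc c))"
  unfolding antimono_iff_le_Suc
proof
  fix c
  have "finite {r. T (r, c) \<noteq> 0}"
    using assms by (intro finite_column) (simp add: tableau_def)
  moreover have "{r. T (r, Suc c) \<noteq> 0} \<subseteq> {r. T (r, c) \<noteq> 0}"
    using tableau_row[OF assms, of _ "Suc c" c] by blast
  ultimately show "col_len T (Suc (Suc c)) \<le> col_len T (Suc c)"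
    by (simp add: col_len_def card_mono)
qed

lemma tableaux_entry:
  assumes "T \<in> tableaux m" "T p \<noteq> 0"
  shows "T p \<in># m"
proof -
  have "p \<in># mset_set (supp T)" using assms by (auto simp: tableaux_def tableau_def supp_def)
  then show ?thesis using assms by (auto simp: tableaux_def)
qed

lemma card_supp: "T \<in> tableaux m \<Longrightarrow> card (supp T) = size m"
  by (auto simp: tableaux_def)

text \<open>If column \<open>i\<close> were nonempty, the first row would have at least
  \<open>i\<close> cells, more than the whole tableau.\<close>

lemma col_len_eq_0:
  assumes T: "T \<in> tableaux m" and i: "size m < i"
  shows "col_len T i = 0"
proof (rule ccontr)
  assume "col_len T i \<noteq> 0"
  have tab: "tableau T" using T by (simp add: tableaux_def)
  have "T (0, i - 1) \<noteq> 0"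
    using \<open>col_len T i \<noteq> 0\<close> nonzero_iff_less_col_len[OF tab, of 0 "i - 1"] i by simp
  then have "T (0, c) \<noteq> 0" if "c < i" for c
    using that tableau_row[OF tab, of 0 "i - 1" c] by (cases "c = i - 1") auto
  then have "Pair 0 ` {..<i} \<subseteq> supp T" by (auto simp: supp_def)
  moreover have "finite (supp T)" using tab by (simp add: tableau_def)
  ultimately have "card (Pair (0::nat) ` {..<i}) \<le> card (supp T)" by (metis card_mono)
  then show False using i card_supp[OF T] by (simp add: card_image inj_on_def)
qed

section \<open>Adding and removing a horizontal strip of largest entries\<close>

definition add_strip :: "nat \<Rightarrow> (nat \<times> nat \<Rightarrow> nat) \<Rightarrow> nat set \<Rightarrow> nat \<times> nat \<Rightarrow> nat" where
  "add_strip M T \<epsilon> = (\<lambda>(r, c). if Suc c \<in> \<epsilon> \<and> r = col_len T (Suc c) then M else T (r, c))"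

definition remove_max :: "nat \<Rightarrow> (nat \<times> nat \<Rightarrow> nat) \<Rightarrow> nat \<times> nat \<Rightarrow> nat" where
  "remove_max M T = (\<lambda>p. if T p = M then 0 else T p)"

definition strip :: "nat \<Rightarrow> (nat \<times> nat \<Rightarrow> nat) \<Rightarrow> nat set" where
  "strip M T = (\<lambda>(r, c). Suc c) ` {p. T p = M}"

text \<open>A horizontal strip has at most one cell per column and is recorded by the set of its
  columns. Nonincreasing column lengths after the addition say that the new shape is again a
  diagram.\<close>

definition horizontal_strips :: "(nat \<times> nat \<Rightarrow> nat) \<Rightarrow> nat \<Rightarrow> nat set set" where
  "horizontal_strips T k = {\<epsilon>. finite \<epsilon> \<and> 0 \<notin> \<epsilon> \<and> card \<epsilon> = k \<and>
     antimono (\<lambda>c. col_len T (Suc c) + of_bool (Suc c \<in> \<epsilon>))}"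

context
  fixes m :: "nat multiset" and M k :: nat
  assumes less_M: "\<And>x. x \<in># m \<Longrightarrow> x < M" and M_pos: "0 < M"
begin

lemma add_strip_nonzero_iff:
  assumes "tableau T"
  shows "add_strip M T \<epsilon> (r, c) \<noteq> 0 \<longleftrightarrow> r < col_len T (Suc c) + of_bool (Suc c \<in> \<epsilon>)"
  using nonzero_iff_less_col_len[OF assms, of r c] M_pos by (auto simp: add_strip_def)

lemma col_len_add_strip:
  assumes "tableau T" "0 \<notin> \<epsilon>"
  shows "col_len (add_strip M T \<epsilon>) i = col_len T i + of_bool (i \<in> \<epsilon>)"
proof (cases i)
  case 0
  then show ?thesis using assms(2) by (simp add: col_len_def)
next
  case (Suc c)
  then show ?thesis
    by (subst col_len_def) (simp add: add_strip_nonzero_iff[OF assms(1), simplified] flip: lessThan_def)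
qed

text \<open>The new entries stand at the bottoms of columns and exceed all old ones, so columns stay
  strict. In a row, a cell left of an old cell is old, and no entry exceeds
  \<open>M\<close>.\<close>

lemma add_strip_in_tableaux:
  assumes T: "T \<in> tableaux m" and \<epsilon>: "\<epsilon> \<in> horizontal_strips T k"
  shows "add_strip M T \<epsilon> \<in> tableaux (m + replicate_mset k M)"
proof -
  have tab: "tableau T" using T by (simp add: tableaux_def)
  have \<epsilon>': "finite \<epsilon>" "0 \<notin> \<epsilon>" "card \<epsilon> = k"
    and anti: "antimono (\<lambda>c. col_len T (Suc c) + of_bool (Suc c \<in> \<epsilon>))"
    using \<epsilon> by (auto simp: horizontal_strips_def)
  let ?X = "add_strip M T \<epsilon>"
  define C where "C = {(r, c). Suc c \<in> \<epsilon> \<and> r = col_len T (Suc c)}"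
  have lessM: "T p < M" for p
    using tableaux_entry[OF T, of p] less_M M_pos by (cases "T p = 0") auto
  have C_image: "C = (\<lambda>i. (col_len T i, i - 1)) ` \<epsilon>"
  proof (intro equalityI subsetI)
    fix p assume "p \<in> C"
    then show "p \<in> (\<lambda>i. (col_len T i, i - 1)) ` \<epsilon>"
      by (auto simp: C_def intro!: image_eqI[where x = "Suc (snd p)"])
  next
    fix p assume "p \<in> (\<lambda>i. (col_len T i, i - 1)) ` \<epsilon>"
    then obtain i where "i \<in> \<epsilon>" "p = (col_len T i, i - 1)" by blast
    then show "p \<in> C" using \<epsilon>'(2) by (cases i) (auto simp: C_def)
  qed
  then have finC: "finite C" using \<epsilon>'(1) by simp
  have old: "?X (r, c) = T (r, c)" if "r < col_len T (Suc c)" for r c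
    using that by (auto simp: add_strip_def)
  have le_M: "?X p \<le> M" for p
    using lessM[of p] by (cases p) (auto simp: add_strip_def)
  have supp: "supp ?X = supp T \<union> C"
    using nonzero_iff_less_col_len[OF tab] M_pos by (auto simp: supp_def add_strip_def C_def split: if_splits)
  have disj: "supp T \<inter> C = {}"
    using nonzero_iff_less_col_len[OF tab] by (auto simp: supp_def C_def)
  have fin: "finite (supp T)" using tab by (simp add: tableau_def)
  have "tableau ?X"
    unfolding tableau_def
  proof (intro conjI allI impI)
    show "finite (supp ?X)" using fin \<epsilon>' by (simp add: supp C_image)
  next
    fix r c c' assume *: "?X (r, c') \<noteq> 0 \<and> c < c'"
    then have "r < col_len T (Suc c') + of_bool (Suc c' \<in> \<epsilon>)"
      using add_strip_nonzero_iff[OF tab] by blast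
    also have "\<dots> \<le> col_len T (Suc c) + of_bool (Suc c \<in> \<epsilon>)"
      using antimonoD[OF anti, of c c'] * by simp
    finally show "?X (r, c) \<noteq> 0"
      using add_strip_nonzero_iff[OF tab] by blast
    show "?X (r, c) \<le> ?X (r, c')"
    proof (cases "r < col_len T (Suc c')")
      case True
      then have "T (r, c) \<noteq> 0 \<and> T (r, c) \<le> T (r, c')"
        using nonzero_iff_less_col_len[OF tab] tableau_row[OF tab] * by blast
      moreover have "?X (r, c') = T (r, c')" using True by (rule old)
      moreover have "?X (r, c) = T (r, c)"
        using calculation(1) nonzero_iff_less_col_len[OF tab] by (intro old) blast
      ultimately show ?thesis by simp
    next
      case False
      then have "?X (r, c') = M"
        using * nonzero_iff_less_col_len[OF tab, of r c'] by (auto simp: add_strip_def split: if_splits)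
      then show ?thesis using le_M by simp
    qed
  next
    fix r r' c assume *: "?X (r', c) \<noteq> 0 \<and> r < r'"
    then have r: "r < col_len T (Suc c)"
      using add_strip_nonzero_iff[OF tab, of \<epsilon> r' c] by (auto split: if_splits simp: of_bool_def)
    then have Xr: "?X (r, c) = T (r, c)" "T (r, c) \<noteq> 0"
      using nonzero_iff_less_col_len[OF tab] by (auto intro: old)
    then show "?X (r, c) \<noteq> 0" by simp
    show "?X (r, c) < ?X (r', c)"
    proof (cases "r' < col_len T (Suc c)")
      case True
      then show ?thesis
        using Xr old[OF True] nonzero_iff_less_col_len[OF tab] tableau_column[OF tab, of r' c r] * by simp
    next
      case False
      then have "?X (r', c) = M"
        using * nonzero_iff_less_col_len[OF tab, of r' c] by (auto simp: add_strip_def split: if_splits)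
      then show ?thesis using Xr lessM by simp
    qed
  qed
  moreover have "image_mset ?X (mset_set (supp ?X)) = m + replicate_mset k M"
  proof -
    have "image_mset ?X (mset_set (supp T)) = image_mset T (mset_set (supp T))"
      using fin nonzero_iff_less_col_len[OF tab] old
      by (intro image_mset_cong) (auto simp: supp_def)
    moreover have "image_mset ?X (mset_set C) = image_mset (\<lambda>_. M) (mset_set C)"
      using finC by (intro image_mset_cong) (auto simp: add_strip_def C_def)
    moreover have "card C = k"
      unfolding C_image using \<epsilon>' by (subst card_image) (auto simp: inj_on_def, metis Suc_pred neq0_conv)
    ultimately show ?thesis
      using T fin \<epsilon>'(1) disj finC by (simp add: supp mset_set_Union tableaux_def image_mset_const_eq)
  qed
  ultimately show ?thesis by (simp add: tableaux_def)
qed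

lemma remove_max_add_strip:
  assumes T: "T \<in> tableaux m" and \<epsilon>: "0 \<notin> \<epsilon>"
  shows "remove_max M (add_strip M T \<epsilon>) = T" "strip M (add_strip M T \<epsilon>) = \<epsilon>"
proof -
  have tab: "tableau T" using T by (simp add: tableaux_def)
  have lessM: "T p < M" for p
    using tableaux_entry[OF T, of p] less_M M_pos by (cases "T p = 0") auto
  have "T p \<noteq> M" for p using lessM[of p] by simp
  then have M_iff: "add_strip M T \<epsilon> (r, c) = M \<longleftrightarrow> Suc c \<in> \<epsilon> \<and> r = col_len T (Suc c)" for r c
    by (auto simp: add_strip_def)
  have "remove_max M (add_strip M T \<epsilon>) (r, c) = T (r, c)" for r c
  proof (cases "Suc c \<in> \<epsilon> \<and> r = col_len T (Suc c)")
    case True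
    then have "T (r, c) = 0" using nonzero_iff_less_col_len[OF tab, of r c] by auto
    then show ?thesis using True by (simp add: remove_max_def add_strip_def)
  next
    case False
    then have "add_strip M T \<epsilon> (r, c) \<noteq> M" using M_iff by blast
    then show ?thesis using False by (auto simp: remove_max_def add_strip_def)
  qed
  then show "remove_max M (add_strip M T \<epsilon>) = T" by auto
  have "i \<in> strip M (add_strip M T \<epsilon>) \<longleftrightarrow> i \<in> \<epsilon>" for i
    using \<epsilon> by (cases i) (auto simp: strip_def image_iff M_iff)
  then show "strip M (add_strip M T \<epsilon>) = \<epsilon>" by blast
qed

text \<open>Columns increase strictly, so \<open>M\<close> occurs at most once in a column, at its
  bottom. Cells above or to the left of an entry smaller than \<open>M\<close> also hold entries
  smaller than \<open>M\<close>, so deletion leaves a tableau.\<close>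

lemma remove_max_properties:
  assumes T: "T \<in> tableaux (m + replicate_mset k M)"
  shows "remove_max M T \<in> tableaux m" "strip M T \<in> horizontal_strips (remove_max M T) k"
    "add_strip M (remove_max M T) (strip M T) = T"
proof -
  have tab: "tableau T" using T by (simp add: tableaux_def)
  have fin: "finite (supp T)" using tab by (simp add: tableau_def)
  have le_M: "T p \<le> M" for p
    using tableaux_entry[OF T, of p] less_M by (cases "T p = 0") (auto split: if_splits intro: less_imp_le)
  have supp_remove: "supp (remove_max M T) = {p \<in> supp T. T p \<noteq> M}"
    by (auto simp: supp_def remove_max_def)
  have tab_remove: "tableau (remove_max M T)"
    unfolding tableau_def
  proof (intro conjI allI impI)
    show "finite (supp (remove_max M T))" using fin by (simp add: supp_remove)
  next
    fix r c c' assume *: "remove_max M T (r, c') \<noteq> 0 \<and> c < c'"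
    then have "T (r, c') \<noteq> 0" "T (r, c') < M" "remove_max M T (r, c') = T (r, c')"
      using le_M[of "(r, c')"] by (auto simp: remove_max_def split: if_splits)
    then show "remove_max M T (r, c) \<noteq> 0" "remove_max M T (r, c) \<le> remove_max M T (r, c')"
      using tableau_row[OF tab, of r c' c] * by (auto simp: remove_max_def)
  next
    fix r r' c assume *: "remove_max M T (r', c) \<noteq> 0 \<and> r < r'"
    then have "T (r', c) \<noteq> 0" "T (r', c) < M" "remove_max M T (r', c) = T (r', c)"
      using le_M[of "(r', c)"] by (auto simp: remove_max_def split: if_splits)
    then show "remove_max M T (r, c) \<noteq> 0" "remove_max M T (r, c) < remove_max M T (r', c)"
      using tableau_column[OF tab, of r' c r] * by (auto simp: remove_max_def)
  qed
  have content: "image_mset T (mset_set (supp T)) = m + replicate_mset k M"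
    using T by (simp add: tableaux_def)
  have "M \<notin># m" using less_M by blast
  have "image_mset (remove_max M T) (mset_set (supp (remove_max M T))) = image_mset T (mset_set (supp (remove_max M T)))"
    using fin unfolding supp_remove by (intro image_mset_cong) (simp add: remove_max_def)
  also have "\<dots> = filter_mset (\<lambda>x. x \<noteq> M) (image_mset T (mset_set (supp T)))"
    using fin by (simp add: supp_remove filter_mset_image_mset filter_mset_mset_set)
  also have "\<dots> = m"
    unfolding content using \<open>M \<notin># m\<close> by (intro multiset_eqI) (auto simp: not_in_iff)
  finally show remove_in: "remove_max M T \<in> tableaux m" using tab_remove by (simp add: tableaux_def)
  let ?C = "{p. T p = M}"
  have C_subset: "?C \<subseteq> supp T" using M_pos by (auto simp: supp_def)
  then have finC: "finite ?C" using fin finite_subset by blast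
  have "card ?C = k"
  proof -
    have "{p \<in> supp T. T p = M} = ?C" using C_subset by blast
    then have "card ?C = size (filter_mset (\<lambda>x. x = M) (image_mset T (mset_set (supp T))))"
      using fin by (simp add: filter_mset_image_mset filter_mset_mset_set)
    also have "\<dots> = k"
      unfolding content using \<open>M \<notin># m\<close> by (simp add: filter_eq_replicate_mset count_eq_zero_iff)
    finally show ?thesis .
  qed
  have inj: "inj_on (\<lambda>(r, c). Suc c) ?C"
  proof -
    have "r = r'" if "T (r, c) = M" "T (r', c) = M" for r r' c
      using that tableau_column[OF tab, of r' c r] tableau_column[OF tab, of r c r'] M_pos
      by (cases r r' rule: linorder_cases) auto
    then show ?thesis by (auto simp: inj_on_def)
  qed
  \<comment> \<open>This turns the strip condition on \<open>strip M T\<close> into the monotonicity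
    of the column lengths of \<open>T\<close>.\<close>
  have col: "col_len T i = col_len (remove_max M T) i + of_bool (i \<in> strip M T)" for i
  proof (cases i)
    case 0
    then show ?thesis by (auto simp: col_len_def strip_def)
  next
    case (Suc c)
    let ?R = "{r. T (r, c) = M}"
    have "{r. T (r, c) \<noteq> 0} = {r. remove_max M T (r, c) \<noteq> 0} \<union> ?R"
      using M_pos by (auto simp: remove_max_def)
    moreover have "{r. remove_max M T (r, c) \<noteq> 0} \<inter> ?R = {}" by (auto simp: remove_max_def)
    moreover have "finite {r. remove_max M T (r, c) \<noteq> 0}"
      using tab_remove by (intro finite_column) (simp add: tableau_def)
    moreover have "finite ?R"
      using finite_column[OF fin, of c] M_pos by (rule_tac finite_subset) auto
    ultimately have "card {r. T (r, c) \<noteq> 0} = card {r. remove_max M T (r, c) \<noteq> 0} + card ?R"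
      by (simp add: card_Un_disjoint)
    moreover have "card ?R = of_bool (Suc c \<in> strip M T)"
    proof (cases "Suc c \<in> strip M T")
      case True
      then obtain r where r: "T (r, c) = M" by (auto simp: strip_def)
      then have "?R = {r}" using inj by (auto simp: inj_on_def)
      then show ?thesis using True by simp
    next
      case False
      then have "?R = {}" by (force simp: strip_def)
      then show ?thesis using False by (simp only: card.empty) simp
    qed
    ultimately show ?thesis using Suc by (simp add: col_len_def)
  qed
  show "strip M T \<in> horizontal_strips (remove_max M T) k"
    using finC \<open>card ?C = k\<close> card_image[OF inj] antimono_col_len[OF tab]
    by (auto simp: horizontal_strips_def col[symmetric] simp flip: strip_def) (auto simp: strip_def)
  have "add_strip M (remove_max M T) (strip M T) (r, c) = T (r, c)" for r c
  proof -
    have "T (r, c) = M \<longleftrightarrow> T (r, c) \<noteq> 0 \<and> \<not> remove_max M T (r, c) \<noteq> 0"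
      using M_pos by (auto simp: remove_max_def)
    also have "\<dots> \<longleftrightarrow> Suc c \<in> strip M T \<and> r = col_len (remove_max M T) (Suc c)"
      unfolding nonzero_iff_less_col_len[OF tab] nonzero_iff_less_col_len[OF tab_remove] col by auto
    finally show ?thesis by (auto simp: add_strip_def remove_max_def)
  qed
  then show "add_strip M (remove_max M T) (strip M T) = T" by auto
qed

text \<open>Adding a strip, and splitting off the entries \<open>M\<close>, are inverse bijections
  between pairs of a tableau with a strip and tableaux of the larger content. The summand sees only
  column lengths, to which a strip adds its indicator.\<close>

lemma sum_tableaux_block:
  assumes fin: "finite (tableaux m)" "\<And>T. T \<in> tableaux m \<Longrightarrow> finite (horizontal_strips T k)"
  shows "finite (tableaux (m + replicate_mset k M))"
    and "(\<Sum>T\<in>tableaux (m + replicate_mset k M). f (col_len T)) =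
      (\<Sum>T\<in>tableaux m. \<Sum>\<epsilon>\<in>horizontal_strips T k. f (\<lambda>i. col_len T i + of_bool (i \<in> \<epsilon>)))"
proof -
  let ?S = "Sigma (tableaux m) (\<lambda>T. horizontal_strips T k)"
  let ?e = "\<lambda>(T, \<epsilon>). add_strip M T \<epsilon>"
  have "tableaux (m + replicate_mset k M) \<subseteq> ?e ` ?S"
  proof
    fix T assume "T \<in> tableaux (m + replicate_mset k M)"
    then show "T \<in> ?e ` ?S"
      using remove_max_properties[of T] by (intro image_eqI[of _ _ "(remove_max M T, strip M T)"]) auto
  qed
  then show "finite (tableaux (m + replicate_mset k M))"
    by (rule finite_subset) (use fin in \<open>intro finite_imageI finite_SigmaI\<close>)
  have "(\<Sum>T\<in>tableaux m. \<Sum>\<epsilon>\<in>horizontal_strips T k. f (\<lambda>i. col_len T i + of_bool (i \<in> \<epsilon>))) =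
      (\<Sum>(T, \<epsilon>)\<in>?S. f (\<lambda>i. col_len T i + of_bool (i \<in> \<epsilon>)))"
    using fin by (intro sum.Sigma) auto
  also have "\<dots> = (\<Sum>T\<in>tableaux (m + replicate_mset k M). f (col_len T))"
  proof (rule sum.reindex_bij_witness[of _ "\<lambda>T. (remove_max M T, strip M T)" ?e])
    fix a assume "a \<in> ?S"
    then obtain T \<epsilon> where a: "a = (T, \<epsilon>)" and T: "T \<in> tableaux m" and \<epsilon>: "\<epsilon> \<in> horizontal_strips T k"
      by auto
    have 0: "0 \<notin> \<epsilon>" "tableau T" using T \<epsilon> by (auto simp: horizontal_strips_def tableaux_def)
    show "(remove_max M (?e a), strip M (?e a)) = a" using remove_max_add_strip[OF T 0(1)] by (simp add: a)
    show "?e a \<in> tableaux (m + replicate_mset k M)" using add_strip_in_tableaux[OF T \<epsilon>] by (simp add: a)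
    show "f (col_len (?e a)) = (case a of (T, \<epsilon>) \<Rightarrow> f (\<lambda>i. col_len T i + of_bool (i \<in> \<epsilon>)))"
    proof -
      have "col_len (add_strip M T \<epsilon>) = (\<lambda>i. col_len T i + of_bool (i \<in> \<epsilon>))"
        using col_len_add_strip[OF 0(2,1)] by blast
      then show ?thesis by (simp add: a)
    qed
  qed (use remove_max_properties in auto)
  finally show "(\<Sum>T\<in>tableaux (m + replicate_mset k M). f (col_len T)) =
      (\<Sum>T\<in>tableaux m. \<Sum>\<epsilon>\<in>horizontal_strips T k. f (\<lambda>i. col_len T i + of_bool (i \<in> \<epsilon>)))" ..
qed

end

text \<open>Columns beyond \<open>size m\<close> are empty in \<open>T\<close>, so a strip reaching
  a column \<open>i > n\<close> has to fill all columns from \<open>size m + 1\<close> to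
  \<open>i\<close>, more than \<open>k\<close> of them. This gives strips the index range of
  \<open>pieri\<close>.\<close>

lemma horizontal_strips_eq:
  assumes T: "T \<in> tableaux m" and n: "size m + k \<le> n"
  shows "horizontal_strips T k = {\<epsilon>. \<epsilon> \<subseteq> {1..n} \<and> card \<epsilon> = k \<and>
    antimono (\<lambda>c. col_len T (Suc c) + of_bool (Suc c \<in> \<epsilon>))}"
proof -
  have "\<epsilon> \<subseteq> {1..n}"
    if \<epsilon>: "finite \<epsilon>" "0 \<notin> \<epsilon>" "card \<epsilon> = k" "antimono (\<lambda>c. col_len T (Suc c) + of_bool (Suc c \<in> \<epsilon>))" for \<epsilon>
  proof (rule subsetI, rule ccontr)
    fix i assume i: "i \<in> \<epsilon>" "i \<notin> {1..n}"
    then obtain c where c: "i = Suc c" "n \<le> c" using \<epsilon>(2) by (cases i) auto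
    have "{size m <.. i} \<subseteq> \<epsilon>"
    proof
      fix j assume j: "j \<in> {size m <.. i}"
      then obtain d where d: "j = Suc d" by (cases j) auto
      have "1 \<le> col_len T (Suc d) + of_bool (Suc d \<in> \<epsilon>)"
        using antimonoD[OF \<epsilon>(4), of d c] j c d i(1) by simp
      then show "j \<in> \<epsilon>" using col_len_eq_0[OF T, of j] j d by (simp split: if_splits add: of_bool_def)
    qed
    then have "card {size m <.. i} \<le> card \<epsilon>" using \<epsilon>(1) by (rule_tac card_mono)
    then show False using c n \<epsilon>(3) by simp
  qed
  then show ?thesis
    unfolding horizontal_strips_def by (auto intro: finite_subset)
qed

lemma tableaux_empty: "tableaux {#} = {\<lambda>_. 0}"
proof -
  have "T = (\<lambda>_. 0)" if "T \<in> tableaux {#}" for T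
    using card_supp[OF that] that by (auto simp: tableaux_def tableau_def supp_def)
  moreover have "(\<lambda>_. 0) \<in> tableaux {#}"
    by (simp add: tableaux_def tableau_def supp_def)
  ultimately show ?thesis by blast
qed

section \<open>Products of complete functions as sums over tableaux\<close>

context elementary_complete
begin

definition complete_prod :: "nat multiset \<Rightarrow> 'a" where
  "complete_prod m = (\<Prod>i\<in>set_mset m. h (count m i))"

lemma complete_prod_block:
  assumes "M \<notin># m" "0 < k"
  shows "complete_prod (m + replicate_mset k M) = complete_prod m * h k"
proof -
  have "(\<Prod>i\<in>set_mset m. h (count (m + replicate_mset k M) i)) = complete_prod m"
    unfolding complete_prod_def using assms by (intro prod.cong) auto
  then show ?thesis
    using assms(1,2) unfolding complete_prod_def
    by (simp add: set_mset_replicate_mset_subset not_in_iff[THEN iffD1] mult.commute)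
qed

text \<open>Iterated Pieri rule, one block of equal entries at a time. The claim covers all
  \<open>n \<ge> size m\<close> because the hypothesis for the smaller content is used with the same
  \<open>n\<close>, which must leave room for \<open>k\<close> new columns.\<close>

lemma complete_prod_eq_sum_tableaux:
  assumes "0 \<notin># m"
  shows "finite (tableaux m) \<and>
    (\<forall>n\<ge>size m. complete_prod m = (\<Sum>T\<in>tableaux m. jacobi_trudi n (col_len T)))"
  using assms
proof (induction m rule: multiset_max_block_induct)
  case empty
  have "jacobi_trudi n (col_len (\<lambda>_. 0)) = 1" for n
  proof -
    have "jacobi_trudi n (col_len (\<lambda>_. 0)) = jacobi_trudi 0 (col_len (\<lambda>_. 0))"
      by (rule jacobi_trudi_stable) (auto simp: col_len_def)
    then show ?thesis by (simp add: jacobi_trudi_def det_fn_def)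
  qed
  then show ?case by (simp add: tableaux_empty complete_prod_def)
next
  case (block m M k)
  have M: "0 < M" "0 \<notin># m" using block.prems block.hyps(2) by auto
  have IH: "finite (tableaux m)"
    "\<And>n. size m \<le> n \<Longrightarrow> complete_prod m = (\<Sum>T\<in>tableaux m. jacobi_trudi n (col_len T))"
    using block.IH M(2) by auto
  have fin: "finite (horizontal_strips T k)" if "T \<in> tableaux m" for T
    unfolding horizontal_strips_eq[OF that order.refl]
    by (rule finite_subset[of _ "Pow {1..size m + k}"]) auto
  note blk = sum_tableaux_block[OF block.hyps(1) M(1) IH(1) fin]
  have "complete_prod (m + replicate_mset k M) =
      (\<Sum>T\<in>tableaux (m + replicate_mset k M). jacobi_trudi n (col_len T))"
    if n: "size (m + replicate_mset k M) \<le> n" for n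
  proof -
    have n': "size m + k \<le> n" using n by simp
    have "complete_prod (m + replicate_mset k M) = h k * complete_prod m"
      using block.hyps by (subst complete_prod_block) (auto simp: mult.commute)
    also have "\<dots> = (\<Sum>T\<in>tableaux m. h k * jacobi_trudi n (col_len T))"
      using n' by (subst IH(2)[of n]) (auto simp: sum_distrib_left)
    also have "\<dots> = (\<Sum>T\<in>tableaux m. \<Sum>\<epsilon>\<in>horizontal_strips T k.
        jacobi_trudi n (\<lambda>i. col_len T i + of_bool (i \<in> \<epsilon>)))"
    proof (intro sum.cong refl)
      fix T assume T: "T \<in> tableaux m"
      then have "tableau T" by (simp add: tableaux_def)
      then show "h k * jacobi_trudi n (col_len T) =
          (\<Sum>\<epsilon>\<in>horizontal_strips T k. jacobi_trudi n (\<lambda>i. col_len T i + of_bool (i \<in> \<epsilon>)))"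
        unfolding horizontal_strips_eq[OF T n']
        by (intro pieri[of _ "size m"] antimono_col_len col_len_eq_0[OF T] n')
    qed
    also have "\<dots> = (\<Sum>T\<in>tableaux (m + replicate_mset k M). jacobi_trudi n (col_len T))"
      by (rule blk(2)[symmetric])
    finally show ?thesis .
  qed
  then show ?case using blk(1) by blast
qed

end

section \<open>Shapes of tableaux\<close>


definition shape :: "(nat \<times> nat \<Rightarrow> nat) \<Rightarrow> nat list" where
  "shape T = map (\<lambda>r. card {c. T (r, c) \<noteq> 0}) [0..<col_len T 1]"

lemma cells_shape:
  assumes T: "tableau T"
  shows "cells (shape T) = supp T"
proof -
  have "(r, c) \<in> cells (shape T) \<longleftrightarrow> (r, c) \<in> supp T" for r c
  proof -
    have "(r, c) \<in> cells (shape T) \<longleftrightarrow> T (r, 0) \<noteq> 0 \<and> T (r, c) \<noteq> 0"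
      unfolding nonzero_iff_less_col_len[OF T, of r 0] nonzero_iff_less_row_len[OF T, of r c]
      by (auto simp: cells_def shape_def)
    also have "\<dots> \<longleftrightarrow> T (r, c) \<noteq> 0"
      using tableau_row[OF T, of r c 0] by (cases "c = 0") auto
    finally show ?thesis by (simp add: supp_def)
  qed
  then show ?thesis by auto
qed

lemma is_partition_shape:
  assumes T: "tableau T"
  shows "is_partition (shape T)"
proof -
  have fin: "finite {c. T (r, c) \<noteq> 0}" for r
    using T by (intro finite_row) (simp add: tableau_def)
  have mono: "card {c. T (r', c) \<noteq> 0} \<le> card {c. T (r, c) \<noteq> 0}" if "r < r'" for r r'
    using that tableau_column[OF T] by (intro card_mono fin) blast
  have pos: "card {c. T (r, c) \<noteq> 0} \<noteq> 0" if "r < col_len T 1" for r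
  proof -
    have "0 \<in> {c. T (r, c) \<noteq> 0}" using that nonzero_iff_less_col_len[OF T, of r 0] by simp
    then show ?thesis using card_gt_0_iff fin by blast
  qed
  have "sorted_wrt (\<ge>) (shape T)"
    using mono by (auto simp: shape_def sorted_wrt_iff_nth_less)
  moreover have "0 \<notin> set (shape T)"
  proof
    assume "0 \<in> set (shape T)"
    then obtain r where "r < col_len T 1" "card {c. T (r, c) \<noteq> 0} = 0" by (auto simp: shape_def)
    then show False using pos by blast
  qed
  ultimately show ?thesis by (simp add: is_partition_def)
qed

lemma ssyt_shape:
  assumes T: "tableau T"
  shows "ssyt (shape T) T"
  unfolding ssyt_def cells_shape[OF T] supp_def mem_Collect_eq
proof (intro conjI)
  show "\<forall>r c c'. T (r, c) \<noteq> 0 \<and> T (r, c') \<noteq> 0 \<and> c < c' \<longrightarrow> T (r, c) \<le> T (r, c')"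
    using tableau_row[OF T] by blast
  show "\<forall>r r' c. T (r, c) \<noteq> 0 \<and> T (r', c) \<noteq> 0 \<and> r < r' \<longrightarrow> T (r, c) < T (r', c)"
    using tableau_column[OF T] by blast
qed simp_all

lemma partition_cells_down:
  assumes "is_partition \<nu>" "(r', c') \<in> cells \<nu>" "r \<le> r'" "c \<le> c'"
  shows "(r, c) \<in> cells \<nu>"
  using assms by (cases "r = r'") (auto simp: is_partition_def cells_def sorted_wrt_iff_nth_less
      intro: order.strict_trans1 order.strict_trans2)

lemma supp_ssyt: "ssyt \<nu> T \<Longrightarrow> supp T = cells \<nu>"
  by (fastforce simp: ssyt_def supp_def)

lemma tableau_ssyt:
  assumes \<nu>: "is_partition \<nu>" and T: "ssyt \<nu> T"
  shows "tableau T"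
proof -
  have nz: "T p \<noteq> 0 \<longleftrightarrow> p \<in> cells \<nu>" for p
    using supp_ssyt[OF T] by (auto simp: supp_def)
  have "cells \<nu> = Sigma {..<length \<nu>} (\<lambda>r. {..<\<nu> ! r})"
    by (auto simp: cells_def)
  then have "finite (supp T)" using supp_ssyt[OF T] by simp
  moreover have "T (r, c) \<noteq> 0 \<and> T (r, c) \<le> T (r, c')" if "T (r, c') \<noteq> 0" "c < c'" for r c c'
    using that partition_cells_down[OF \<nu>, of r c' r c] T unfolding nz ssyt_def by auto
  moreover have "T (r, c) \<noteq> 0 \<and> T (r, c) < T (r', c)" if "T (r', c) \<noteq> 0" "r < r'" for r r' c
    using that partition_cells_down[OF \<nu>, of r' c r c] T unfolding nz ssyt_def by auto
  ultimately show ?thesis unfolding tableau_def by blast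
qed

lemma shape_ssyt:
  assumes \<nu>: "is_partition \<nu>" and T: "ssyt \<nu> T"
  shows "shape T = \<nu>"
proof (rule nth_equalityI)
  have nz: "T p \<noteq> 0 \<longleftrightarrow> p \<in> cells \<nu>" for p
    using supp_ssyt[OF T] by (auto simp: supp_def)
  have "{r. T (r, 0) \<noteq> 0} = {..<length \<nu>}"
    unfolding nz using \<nu> by (auto simp: cells_def is_partition_def in_set_conv_nth)
  then have col: "col_len T 1 = length \<nu>" by (simp add: col_len_def)
  then show "length (shape T) = length \<nu>" by (simp add: shape_def)
  fix r assume "r < length (shape T)"
  then have r: "r < length \<nu>" using col by (simp add: shape_def)
  then have "{c. T (r, c) \<noteq> 0} = {..<\<nu> ! r}" unfolding nz by (auto simp: cells_def)
  then show "shape T ! r = \<nu> ! r" using r col by (simp add: shape_def)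
qed

text \<open>An \<open>ssyt\<close> filling of \<open>\<nu>\<close> is nonzero exactly on the diagram
  of \<open>\<nu>\<close>, so its shape recovers \<open>\<nu>\<close>.\<close>

lemma schur_eq_card_tableaux:
  assumes "is_partition \<nu>"
  shows "schur \<nu> m = int (card {T \<in> tableaux m. shape T = \<nu>})"
proof -
  have "ssyt \<nu> T \<and> image_mset T (mset_set (cells \<nu>)) = m \<longleftrightarrow> T \<in> tableaux m \<and> shape T = \<nu>" for T
  proof
    assume "ssyt \<nu> T \<and> image_mset T (mset_set (cells \<nu>)) = m"
    then show "T \<in> tableaux m \<and> shape T = \<nu>"
      using tableau_ssyt shape_ssyt supp_ssyt assms by (auto simp: tableaux_def)
  next
    assume "T \<in> tableaux m \<and> shape T = \<nu>"
    then show "ssyt \<nu> T \<and> image_mset T (mset_set (cells \<nu>)) = m"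
      using ssyt_shape cells_shape by (auto simp: tableaux_def)
  qed
  then show ?thesis by (simp add: schur_def)
qed

lemma conj_part_shape:
  assumes T: "tableau T" and i: "0 < i"
  shows "conj_part (shape T) i = col_len T i"
proof -
  have "{r. r < length (shape T) \<and> i \<le> shape T ! r} = {r. (r, i - 1) \<in> cells (shape T)}"
    using i by (auto simp: cells_def)
  also have "\<dots> = {r. T (r, i - 1) \<noteq> 0}"
    using cells_shape[OF T] by (auto simp: supp_def)
  finally show ?thesis using i by (simp add: conj_part_def col_len_def)
qed

lemma first_part_shape_le:
  assumes "T \<in> tableaux m"
  shows "first_part (shape T) \<le> size m"
proof -
  have T: "tableau T" using assms by (simp add: tableaux_def)
  then have fin: "finite (supp T)" by (simp add: tableau_def)
  have "card {c. T (0, c) \<noteq> 0} = card (Pair (0::nat) ` {c. T (0, c) \<noteq> 0})"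
    by (simp add: card_image inj_on_def)
  also have "\<dots> \<le> card (supp T)"
    using fin by (intro card_mono) (auto simp: supp_def)
  finally show ?thesis
    using card_supp[OF assms] by (auto simp: first_part_def shape_def hd_map hd_upt upt_conv_Cons)
qed

lemma conj_part_eq_0:
  assumes "is_partition \<nu>" "first_part \<nu> < i"
  shows "conj_part \<nu> i = 0"
proof -
  have "\<nu> ! r < i" if "r < length \<nu>" for r
    using that assms by (cases \<nu>; cases r) (auto simp: first_part_def is_partition_def intro: le_less_trans)
  then have "{r. r < length \<nu> \<and> i \<le> \<nu> ! r} = {}" by (auto simp: not_le)
  then show ?thesis unfolding conj_part_def by (simp only: card.empty)
qed

context elementary_complete
begin

text \<open>The size \<open>size m\<close> is common to all tableaux of content \<open>m\<close>.
  Columns of length zero do not change the determinant, which can therefore be cut down to the size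
  used in \<open>nc_schur\<close>.\<close>

lemma jacobi_trudi_shape:
  assumes "T \<in> tableaux m"
  shows "jacobi_trudi (size m) (col_len T) = jacobi_trudi (first_part (shape T)) (conj_part (shape T))"
proof -
  have T: "tableau T" using assms by (simp add: tableaux_def)
  have "jacobi_trudi (size m) (col_len T) = jacobi_trudi (size m) (conj_part (shape T))"
    unfolding jacobi_trudi_def by (rule det_fn_cong) (simp add: conj_part_shape[OF T])
  also have "\<dots> = jacobi_trudi (first_part (shape T)) (conj_part (shape T))"
    using first_part_shape_le[OF assms] conj_part_eq_0[OF is_partition_shape[OF T]]
    by (rule jacobi_trudi_stable)
  finally show ?thesis .
qed

text \<open>Tableaux are grouped by shape. The number \<open>schur \<nu> m\<close> is a Kostka
  number, so this is the classical expansion of a product of complete functions into Schur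
  functions.\<close>

lemma complete_prod_eq_sum_schur:
  assumes "0 \<notin># m"
  shows "finite (shape ` tableaux m)"
    and "complete_prod m =
      (\<Sum>\<nu>\<in>shape ` tableaux m. of_int (schur \<nu> m) * jacobi_trudi (first_part \<nu>) (conj_part \<nu>))"
proof -
  let ?J = "\<lambda>\<nu>. jacobi_trudi (first_part \<nu>) (conj_part \<nu>)"
  have fin: "finite (tableaux m)"
    and eq: "complete_prod m = (\<Sum>T\<in>tableaux m. jacobi_trudi (size m) (col_len T))"
    using complete_prod_eq_sum_tableaux[OF assms] by auto
  show "finite (shape ` tableaux m)" using fin by simp
  have "complete_prod m = (\<Sum>T\<in>tableaux m. ?J (shape T))"
    unfolding eq by (intro sum.cong refl jacobi_trudi_shape)
  also have "\<dots> = (\<Sum>\<nu>\<in>shape ` tableaux m. \<Sum>T\<in>{T \<in> tableaux m. shape T = \<nu>}. ?J (shape T))"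
    using fin by (rule sum.image_gen)
  also have "\<dots> = (\<Sum>\<nu>\<in>shape ` tableaux m. of_int (schur \<nu> m) * ?J \<nu>)"
  proof (intro sum.cong refl)
    fix \<nu> assume "\<nu> \<in> shape ` tableaux m"
    then have "is_partition \<nu>" using is_partition_shape by (auto simp: tableaux_def)
    then show "(\<Sum>T\<in>{T \<in> tableaux m. shape T = \<nu>}. ?J (shape T)) = of_int (schur \<nu> m) * ?J \<nu>"
      by (simp add: schur_eq_card_tableaux)
  qed
  finally show "complete_prod m = (\<Sum>\<nu>\<in>shape ` tableaux m. of_int (schur \<nu> m) * ?J \<nu>)" .
qed

end

section \<open>Noncommutative complete functions and the series\<close>


lemma lookup_single_mult:
  fixes g :: nc_poly
  shows "Poly_Mapping.lookup (Poly_Mapping.single v c * g) w =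
    (if take (length v) w = v then c * Poly_Mapping.lookup g (drop (length v) w) else 0)"
proof (induction g rule: poly_mapping_induct_single)
  case (single x d)
  have "v @ x = w \<longleftrightarrow> take (length v) w = v \<and> drop (length v) w = x"
    by (metis append_eq_conv_conj append_take_drop_id)
  then show ?case
    by (auto simp: mult_single plus_list_def lookup_single when_def)
qed (simp_all add: distrib_left lookup_add)

lemma poly_mapping_eq_sum_single:
  "f = (\<Sum>v\<in>Poly_Mapping.keys f. Poly_Mapping.single v (Poly_Mapping.lookup f v))"
  by (rule poly_mapping_eqI) (simp add: lookup_sum lookup_single when_def in_keys_iff)

text \<open>All words of \<open>f\<close> have length \<open>d\<close>, so a word of the product can
  be factored in only one way.\<close>

lemma lookup_mult_homogeneous:
  fixes f g :: nc_poly
  assumes "\<And>v. v \<in> Poly_Mapping.keys f \<Longrightarrow> length v = d"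
  shows "Poly_Mapping.lookup (f * g) w =
    Poly_Mapping.lookup f (take d w) * Poly_Mapping.lookup g (drop d w)"
proof -
  have "f * g = (\<Sum>v\<in>Poly_Mapping.keys f. Poly_Mapping.single v (Poly_Mapping.lookup f v) * g)"
    by (subst (1) poly_mapping_eq_sum_single[of f]) (rule sum_distrib_right)
  then have "Poly_Mapping.lookup (f * g) w = (\<Sum>v\<in>Poly_Mapping.keys f.
      Poly_Mapping.lookup (Poly_Mapping.single v (Poly_Mapping.lookup f v) * g) w)"
    by (simp only: lookup_sum)
  also have "\<dots> = (\<Sum>v\<in>Poly_Mapping.keys f. if take d w = v then
      Poly_Mapping.lookup f v * Poly_Mapping.lookup g (drop d w) else 0)"
    by (intro sum.cong refl) (simp only: lookup_single_mult assms)
  also have "\<dots> = Poly_Mapping.lookup f (take d w) * Poly_Mapping.lookup g (drop d w)"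
    by (simp add: in_keys_iff)
  finally show ?thesis .
qed

lemma lookup_sum_word_monom:
  "finite W \<Longrightarrow> Poly_Mapping.lookup (sum word_monom W) w = of_bool (w \<in> W)"
  by (simp add: lookup_sum word_monom_eq_single lookup_single when_def)

lemma pairing_of_int_mult: "pairing (of_int c * f) g = c * pairing f g"
proof -
  have "(of_int c :: nc_poly) = Poly_Mapping.single [] c"
    by (simp add: single_of_int[symmetric] zero_list_def[symmetric])
  then have "Poly_Mapping.lookup (of_int c * f) w = c * Poly_Mapping.lookup f w" for w
    by (simp add: lookup_single_mult)
  then show ?thesis
    by (simp add: pairing_eq_sum[OF finite_keys order.refl] sum_distrib_left mult.assoc)
qed

text \<open>The condition on adjacent letters says exactly that \<open>Des lt w\<close> is
  empty.\<close>

definition nc_h :: "nat \<Rightarrow> (letter \<Rightarrow> letter \<Rightarrow> bool) \<Rightarrow> nat \<Rightarrow> nc_poly" where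
  "nc_h N lt k =
     (\<Sum>w | w \<in> lists (alphabet N) \<and> length w = k \<and> successively (\<lambda>x y. \<not> col_ge lt x y) w.
       word_monom w)"

lemma finite_alphabet [simp]: "finite (alphabet N)"
  by (simp add: alphabet_def)

lemma lookup_nc_h:
  "Poly_Mapping.lookup (nc_h N lt k) w =
    of_bool (w \<in> lists (alphabet N) \<and> length w = k \<and> successively (\<lambda>x y. \<not> col_ge lt x y) w)"
  by (simp add: nc_h_def lookup_sum_word_monom)

lemma lookup_nc_e:
  "Poly_Mapping.lookup (nc_e N lt (int k)) w =
    of_bool (w \<in> lists (alphabet N) \<and> length w = k \<and> successively (col_ge lt) w)"
  by (simp add: nc_e_def lookup_sum_word_monom)

lemma nc_h_0: "nc_h N lt 0 = 1"
proof -
  have "{w. w \<in> lists (alphabet N) \<and> w = [] \<and> successively (\<lambda>x y. \<not> col_ge lt x y) w} = {[]}"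
    by auto
  then show ?thesis
    by (simp add: nc_h_def word_monom_def)
qed

text \<open>If \<open>P\<close> holds for the first two letters, the split before the first letter
  contributes nothing and the others are the splits of the tail with opposite sign. Otherwise only
  the splits just before and just after the first letter can contribute, and they cancel.\<close>

lemma alternating_sum_split_word:
  assumes "w \<noteq> []"
  shows "(\<Sum>i\<le>length w. (- 1) ^ i *
    of_bool (successively P (take i w) \<and> successively (\<lambda>x y. \<not> P x y) (drop i w))) = (0::int)"
  using assms
proof (induction w rule: induct_list012)
  case (3 a b v)
  let ?f = "\<lambda>w i. (- 1) ^ i *
    of_bool (successively P (take i w) \<and> successively (\<lambda>x y. \<not> P x y) (drop i w)) :: int"
  have split: "(\<Sum>i\<le>length (a # b # v). ?f (a # b # v) i) =
      ?f (a # b # v) 0 + (\<Sum>i\<le>Suc (length v). ?f (a # b # v) (Suc i))"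
    by (simp only: length_Cons sum.atMost_Suc_shift)
  show ?case
  proof (cases "P a b")
    case True
    have "?f (a # b # v) (Suc i) = - ?f (b # v) i" for i
      using True by (cases i) auto
    then have "(\<Sum>i\<le>Suc (length v). ?f (a # b # v) (Suc i)) = - (\<Sum>i\<le>length (b # v). ?f (b # v) i)"
      by (simp only: length_Cons sum_negf)
    moreover have "?f (a # b # v) 0 = 0" using True by simp
    ultimately show ?thesis unfolding split using "3.IH"(2) by simp
  next
    case False
    have "?f (a # b # v) (Suc (Suc i)) = 0" for i using False by simp
    then have "(\<Sum>i\<le>Suc (length v). ?f (a # b # v) (Suc i)) = ?f (a # b # v) (Suc 0)"
      by (simp only: sum.atMost_Suc_shift sum.neutral_const add_0_right)
    then show ?thesis unfolding split using False by simp
  qed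
qed auto

text \<open>The coefficient of a word of length \<open>k\<close> is the alternating sum over its
  splits into a prefix with a descent at every step and a suffix without descents.\<close>

lemma nc_e_nc_h:
  assumes "0 < k"
  shows "(\<Sum>i\<le>k. (- 1) ^ i * nc_e N lt (int i) * nc_h N lt (k - i)) = 0"
proof (rule poly_mapping_eqI)
  fix w :: "letter list"
  have "Poly_Mapping.lookup (nc_e N lt (int i) * nc_h N lt (k - i)) w =
      of_bool (w \<in> lists (alphabet N) \<and> length w = k) *
      of_bool (successively (col_ge lt) (take i w) \<and> successively (\<lambda>x y. \<not> col_ge lt x y) (drop i w))"
    if "i \<le> k" for i
  proof -
    have "length v = i" if "v \<in> Poly_Mapping.keys (nc_e N lt (int i))" for v
      using that by (simp add: in_keys_iff lookup_nc_e split: if_splits)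
    then have "Poly_Mapping.lookup (nc_e N lt (int i) * nc_h N lt (k - i)) w =
        Poly_Mapping.lookup (nc_e N lt (int i)) (take i w) * Poly_Mapping.lookup (nc_h N lt (k - i)) (drop i w)"
      by (rule lookup_mult_homogeneous)
    moreover have "w \<in> lists (alphabet N) \<longleftrightarrow>
        take i w \<in> lists (alphabet N) \<and> drop i w \<in> lists (alphabet N)"
      by (metis append_in_lists_conv append_take_drop_id)
    ultimately show ?thesis
      using that by (auto simp: lookup_nc_e lookup_nc_h)
  qed
  note coeff = this
  have sign: "Poly_Mapping.lookup ((- 1) ^ i * f) w = (- 1) ^ i * Poly_Mapping.lookup f w"
    for i and f :: nc_poly
    by (cases "even i") simp_all
  have "Poly_Mapping.lookup (\<Sum>i\<le>k. (- 1) ^ i * nc_e N lt (int i) * nc_h N lt (k - i)) w =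
      (\<Sum>i\<le>k. (- 1) ^ i * Poly_Mapping.lookup (nc_e N lt (int i) * nc_h N lt (k - i)) w)"
    by (simp only: lookup_sum mult.assoc sign)
  also have "\<dots> =
      of_bool (w \<in> lists (alphabet N) \<and> length w = k) *
      (\<Sum>i\<le>k. (- 1) ^ i * of_bool (successively (col_ge lt) (take i w) \<and>
        successively (\<lambda>x y. \<not> col_ge lt x y) (drop i w)))"
    unfolding sum_distrib_left
    by (intro sum.cong refl) (simp only: coeff atMost_iff mult.left_commute)
  also have "\<dots> = 0"
    using alternating_sum_split_word[of w "col_ge lt"] assms by (cases "length w = k") auto
  finally show "Poly_Mapping.lookup (\<Sum>i\<le>k. (- 1) ^ i * nc_e N lt (int i) * nc_h N lt (k - i)) w =
    Poly_Mapping.lookup 0 w" by simp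
qed

section \<open>Elementary and complete functions as commutative polynomials\<close>

definition elem_sym :: "int \<Rightarrow> (nat multiset \<Rightarrow>\<^sub>0 int)" where
  "elem_sym k = (if k < 0 then 0 else if k = 0 then 1 else Poly_Mapping.single {#nat k#} 1)"

text \<open>The recursion is the alternating relation between elementary and complete functions,
  solved for the complete function of highest degree.\<close>

fun complete_sym :: "nat \<Rightarrow> (nat multiset \<Rightarrow>\<^sub>0 int)" where
  "complete_sym 0 = 1"
| "complete_sym (Suc k) = (\<Sum>i\<le>k. (- 1) ^ i * elem_sym (int (Suc i)) * complete_sym (k - i))"

interpretation sym: elementary_complete elem_sym complete_sym
proof
  fix k :: nat assume "0 < k"
  then obtain n where k: "k = Suc n" by (cases k) auto
  have "(\<Sum>i\<le>k. (- 1) ^ i * elem_sym (int i) * complete_sym (k - i)) =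
      complete_sym k + (\<Sum>i\<le>n. (- 1) ^ Suc i * elem_sym (int (Suc i)) * complete_sym (n - i))"
    unfolding k by (subst sum.atMost_Suc_shift) (simp add: elem_sym_def)
  also have "\<dots> = 0" by (simp add: k sum_negf)
  \<comment> \<open>Multiplication by \<open>(- 1) ^ k\<close> moves the alternating sign from the
    elementary to the complete factor, where \<open>sum_h_E\<close> has it.\<close>
  finally have "0 = (- 1) ^ k * (\<Sum>i\<le>k. (- 1) ^ i * elem_sym (int i) * complete_sym (k - i))" by simp
  also have "\<dots> = (\<Sum>i\<le>k. (- 1) ^ (k - i) * complete_sym (k - i) * elem_sym (int i))"
    unfolding sum_distrib_left
  proof (intro sum.cong refl)
    fix i assume "i \<in> {..k}"
    then have "(- 1 :: nat multiset \<Rightarrow>\<^sub>0 int) ^ k = (- 1) ^ (k - i) * (- 1) ^ i"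
      by (simp flip: power_add)
    moreover have "(- 1 :: nat multiset \<Rightarrow>\<^sub>0 int) ^ i * (- 1) ^ i = 1"
      by (simp flip: power_mult_distrib)
    ultimately show "(- 1) ^ k * ((- 1) ^ i * elem_sym (int i) * complete_sym (k - i)) =
        (- 1) ^ (k - i) * complete_sym (k - i) * elem_sym (int i)"
      by (metis (no_types, lifting) mult.assoc mult.commute mult.right_neutral)
  qed
  also have "\<dots> = (\<Sum>l\<le>k. (- 1) ^ l * complete_sym l * elem_sym (int k - int l))"
    by (rule sum.reindex_bij_witness[of _ "\<lambda>l. k - l" "\<lambda>l. k - l"]) (auto simp: of_nat_diff)
  finally show "(\<Sum>l\<le>k. (- 1) ^ l * complete_sym l * elem_sym (int k - int l)) = 0" by simp
qed (simp_all add: elem_sym_def)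

text \<open>The words whose fundamental quasisymmetric series contains the monomial \<open>m\<close>.\<close>

definition compatible :: "(letter \<Rightarrow> letter \<Rightarrow> bool) \<Rightarrow> nat multiset \<Rightarrow> letter list \<Rightarrow> bool" where
  "compatible lt m w \<longleftrightarrow> length w = size m \<and>
     (\<forall>j\<in>Des lt w. sorted_list_of_multiset m ! (j - 1) < sorted_list_of_multiset m ! j)"

text \<open>Only one sorted list has content \<open>m\<close>, so the count is 0 or 1.\<close>

lemma Q_eq_compatible:
  assumes "0 \<notin># m"
  shows "Q (length w) (Des lt w) m = of_bool (compatible lt m w)"
proof -
  have "{is. length is = length w \<and> 0 \<notin> set is \<and> sorted is \<and>
      (\<forall>j\<in>Des lt w. is ! (j - 1) < is ! j) \<and> mset is = m} =
      (if compatible lt m w then {sorted_list_of_multiset m} else {})" (is "?L = ?R")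
  proof (rule Set.set_eqI)
    fix xs
    have "sorted xs \<and> mset xs = m \<longleftrightarrow> xs = sorted_list_of_multiset m"
      using sorted_list_of_multiset_mset[of xs] by (auto simp: sorted_sort_id)
    then have "xs \<in> ?L \<longleftrightarrow> xs = sorted_list_of_multiset m \<and> length xs = length w \<and> 0 \<notin> set xs \<and>
        (\<forall>j\<in>Des lt w. xs ! (j - 1) < xs ! j)"
      by blast
    also have "\<dots> \<longleftrightarrow> xs \<in> ?R"
      using assms size_mset[of "sorted_list_of_multiset m"]
      by (auto simp: compatible_def)
    finally show "xs \<in> ?L \<longleftrightarrow> xs \<in> ?R" .
  qed
  then show ?thesis by (simp add: Q_def)
qed

text \<open>Inside the final block the indices are constant, so no descent is allowed there. At its
  beginning the index jumps up to \<open>M\<close>, so a descent is allowed and nothing links the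
  two parts of the word.\<close>

lemma compatible_block:
  assumes less_M: "\<And>x. x \<in># m \<Longrightarrow> x < M"
  shows "compatible lt (m + replicate_mset k M) w \<longleftrightarrow>
    compatible lt m (take (size m) w) \<and>
    length (drop (size m) w) = k \<and> successively (\<lambda>x y. \<not> col_ge lt x y) (drop (size m) w)"
proof -
  define s where "s = sorted_list_of_multiset m"
  define d where "d = size m"
  have s: "mset s = m" "sorted s" "length s = d"
    using size_mset[of s] by (simp_all add: s_def d_def)
  have set_s: "x < M" if "x \<in> set s" for x
    using that less_M s(1) by auto
  have "sorted (s @ replicate k M)"
    using s(2) set_s by (auto simp: sorted_append intro: less_imp_le)
  then have s': "sorted_list_of_multiset (m + replicate_mset k M) = s @ replicate k M"
    using sorted_list_of_multiset_mset[of "s @ replicate k M"] s(1) by (simp add: sorted_sort_id)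
  have Des: "j \<in> Des lt v \<longleftrightarrow> 1 \<le> j \<and> j < length v \<and> col_ge lt (v ! (j - 1)) (v ! j)" for v j
    by (auto simp: Des_def col_ge_def)
  show ?thesis
  proof (cases "length w = d + k")
    case False
    then show ?thesis by (auto simp: compatible_def d_def)
  next
    case True
    have nth_s': "(s @ replicate k M) ! j = (if j < d then s ! j else M)" if "j < d + k" for j
      using that s(3) by (simp add: nth_append)
    have step: "(s @ replicate k M) ! (j - 1) < (s @ replicate k M) ! j \<longleftrightarrow>
        (if j < d then s ! (j - 1) < s ! j else j = d)" if "1 \<le> j" "j < d + k" for j
      using that set_s s(3) by (auto simp: nth_s')
    have "compatible lt (m + replicate_mset k M) w \<longleftrightarrow>
        (\<forall>j. 1 \<le> j \<and> j < d + k \<and> col_ge lt (w ! (j - 1)) (w ! j) \<longrightarrow>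
          (if j < d then s ! (j - 1) < s ! j else j = d))"
      unfolding compatible_def s' using True step by (auto simp: Des d_def)
    also have "\<dots> \<longleftrightarrow>
        (\<forall>j. 1 \<le> j \<and> j < d \<and> col_ge lt (w ! (j - 1)) (w ! j) \<longrightarrow> s ! (j - 1) < s ! j) \<and>
        (\<forall>i. Suc i < k \<longrightarrow> \<not> col_ge lt (w ! (d + i)) (w ! Suc (d + i)))" (is "?L \<longleftrightarrow> ?A \<and> ?B")
    proof
      assume L: ?L
      have ?A using L by auto
      moreover have ?B
      proof (intro allI impI notI)
        fix i assume "Suc i < k" "col_ge lt (w ! (d + i)) (w ! Suc (d + i))"
        then show False using L[rule_format, of "Suc (d + i)"] by simp
      qed
      ultimately show "?A \<and> ?B" ..
    next
      assume AB: "?A \<and> ?B"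
      show ?L
      proof (intro allI impI)
        fix j assume j: "1 \<le> j \<and> j < d + k \<and> col_ge lt (w ! (j - 1)) (w ! j)"
        show "if j < d then s ! (j - 1) < s ! j else j = d"
        proof (cases "j \<le> d")
          case True
          then show ?thesis using AB j by auto
        next
          case False
          then obtain i where "j = Suc (d + i)" using less_imp_Suc_add[of d j] by auto
          then show ?thesis using AB j by auto
        qed
      qed
    qed
    also have "?A \<longleftrightarrow> compatible lt m (take d w)"
      using True by (auto simp: compatible_def Des s_def[symmetric] d_def[symmetric])
    also have "?B \<longleftrightarrow> successively (\<lambda>x y. \<not> col_ge lt x y) (drop d w)"
      using True by (auto simp: successively_conv_nth)
    finally show ?thesis using True by (simp add: d_def)
  qed
qed

lemma F_series_eq_pairing:
  assumes "0 \<notin># m" "Poly_Mapping.keys \<gamma> \<subseteq> lists (alphabet N)"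
    and f: "\<And>w. Poly_Mapping.lookup f w = of_bool (w \<in> lists (alphabet N) \<and> compatible lt m w)"
  shows "F_series lt \<gamma> m = pairing f \<gamma>"
  unfolding F_series_def pairing_eq_sum[OF finite_keys order.refl] Q_eq_compatible[OF assms(1)]
  using assms(2) by (intro sum.cong refl) (auto simp: f)

lemma F_series_zero_index: "0 \<in># m \<Longrightarrow> F_series lt \<gamma> m = 0"
proof -
  assume m: "0 \<in># m"
  have "{is. length is = t \<and> 0 \<notin> set is \<and> sorted is \<and> (\<forall>j\<in>D. is ! (j - 1) < is ! j) \<and> mset is = m} = {}"
    for t D using m by auto
  then have "Q t D m = 0" for t D by (simp only: Q_def card.empty)
  then show ?thesis by (simp add: F_series_def)
qed

lemma schur_zero_index: "0 \<in># m \<Longrightarrow> schur \<nu> m = 0"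
proof -
  assume m: "0 \<in># m"
  have "image_mset T (mset_set (cells \<nu>)) \<noteq> m" if T: "ssyt \<nu> T" for T
  proof
    assume "image_mset T (mset_set (cells \<nu>)) = m"
    then obtain p where "p \<in># mset_set (cells \<nu>)" "T p = 0" using m by auto
    then show False
      using T by (cases "finite (cells \<nu>)") (auto simp: ssyt_def)
  qed
  then have "{T. ssyt \<nu> T \<and> image_mset T (mset_set (cells \<nu>)) = m} = {}" by blast
  then show ?thesis by (simp only: schur_def card.empty)
qed

text \<open>Only the multiplicities enter, and an injective renaming preserves them.\<close>

lemma complete_prod_image_mset:
  assumes "inj \<pi>"
  shows "sym.complete_prod (image_mset \<pi> m) = sym.complete_prod m"
proof -
  have "count (image_mset \<pi> m) (\<pi> i) = count m i" for i
    using assms by (induction m) (auto simp: inj_eq)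
  then show ?thesis
    unfolding sym.complete_prod_def by (simp add: prod.reindex inj_on_subset[OF assms])
qed

section \<open>Transfer of the commutative identities to the series of
  \<open>\<gamma>\<close>\<close>

locale plactic_annihilator =
  fixes N :: nat and lt :: "letter \<Rightarrow> letter \<Rightarrow> bool" and \<gamma> :: nc_poly
  assumes order: "shuffle_order N lt" and orth: "\<gamma> \<in> orth_compl N (plac_ideal N lt)"

sublocale plactic_annihilator \<subseteq> plactic_ideal "annihilator \<gamma>" "alphabet N" lt
  using order orth by (rule plactic_ideal_annihilator)

sublocale plactic_annihilator \<subseteq> commuting_family "annihilator \<gamma>" "\<lambda>k. nc_e N lt (int k)"
  by unfold_locales (simp add: nc_e_eq_e_on e_on_commute)

context plactic_annihilator
begin

lemma pairing_represents:
  "represents f F \<Longrightarrow> represents g F \<Longrightarrow> pairing f \<gamma> = pairing g \<gamma>"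
  unfolding represents_def
  by (metis pairing_annihilator pairing_diff right_minus_eq)

lemma represents_nc_e: "represents (nc_e N lt k) (elem_sym k)"
proof (cases "k \<le> 0")
  case True
  moreover have "nc_e N lt k = 0" if "k < 0" using that by (simp add: nc_e_def)
  ultimately show ?thesis by (cases "k = 0") (auto simp: elem_sym_def nc_e_0)
next
  case False
  then show ?thesis using represents_gen[of "nat k"] by (simp add: elem_sym_def)
qed

lemma represents_sign: "represents ((- 1) ^ i) ((- 1) ^ i)"
  using represents_of_int[of "(- 1) ^ i"] by simp

text \<open>\<open>nc_e_nc_h\<close> gives \<open>nc_h\<close> the same recursion that defines
  \<open>complete_sym\<close>, with coefficients that are already represented.\<close>

lemma represents_nc_h: "represents (nc_h N lt k) (complete_sym k)"
proof (induction k rule: less_induct)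
  case (less k)
  show ?case
  proof (cases k)
    case 0
    then show ?thesis by (simp add: nc_h_0)
  next
    case (Suc n)
    have "0 = (\<Sum>i\<le>Suc n. (- 1) ^ i * nc_e N lt (int i) * nc_h N lt (Suc n - i))"
      by (rule nc_e_nc_h[symmetric]) simp
    also have "\<dots> = nc_h N lt (Suc n) + (\<Sum>i\<le>n. (- 1) ^ Suc i * nc_e N lt (int (Suc i)) * nc_h N lt (n - i))"
      by (subst sum.atMost_Suc_shift) (simp add: nc_e_0)
    finally have "nc_h N lt (Suc n) = (\<Sum>i\<le>n. (- 1) ^ i * nc_e N lt (int (Suc i)) * nc_h N lt (n - i))"
      by (simp add: sum_negf)
    moreover have "represents (\<Sum>i\<le>n. (- 1) ^ i * nc_e N lt (int (Suc i)) * nc_h N lt (n - i))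
        (\<Sum>i\<le>n. (- 1) ^ i * elem_sym (int (Suc i)) * complete_sym (n - i))"
      using less Suc by (intro represents_sum represents_mult represents_sign represents_nc_e) auto
    ultimately show ?thesis by (simp only: Suc complete_sym.simps)
  qed
qed

lemma represents_nc_schur:
  "represents (nc_schur N lt \<nu>) (sym.jacobi_trudi (first_part \<nu>) (conj_part \<nu>))"
proof -
  have "(\<Prod>i=1..n. f i) = prod_list (map f [1..<Suc n])" for n and f :: "nat \<Rightarrow> nat multiset \<Rightarrow>\<^sub>0 int"
    using prod.distinct_set_conv_list[of "[1..<Suc n]" f]
    by (simp add: atLeastLessThanSuc_atLeastAtMost del: upt_Suc)
  then show ?thesis
    unfolding nc_schur_def sym.jacobi_trudi_def det_fn_def
    by (auto simp del: upt_Suc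
        intro!: represents_sum represents_mult represents_of_int represents_prod_list represents_nc_e)
qed

text \<open>The witness is the product of \<open>nc_h\<close> over the multiplicities of
  \<open>m\<close>, in increasing order of the index: by \<open>compatible_block\<close>, each
  further factor appends one block without descents.\<close>

lemma represents_compatible_words:
  "\<exists>f. represents f (sym.complete_prod m) \<and>
    (\<forall>w. Poly_Mapping.lookup f w = of_bool (w \<in> lists (alphabet N) \<and> compatible lt m w))"
proof (induction m rule: multiset_max_block_induct)
  case empty
  have "Poly_Mapping.lookup (1 :: nc_poly) w = of_bool (w \<in> lists (alphabet N) \<and> compatible lt {#} w)" for w
    by (auto simp: compatible_def Des_def lookup_one zero_list_def when_def)
  then show ?case
    by (intro exI[of _ 1]) (simp add: sym.complete_prod_def)
next
  case (block m M k)
  then obtain f where f: "represents f (sym.complete_prod m)"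
    "\<And>w. Poly_Mapping.lookup f w = of_bool (w \<in> lists (alphabet N) \<and> compatible lt m w)"
    by blast
  have "M \<notin># m" using block.hyps(1) by blast
  then have "represents (f * nc_h N lt k) (sym.complete_prod (m + replicate_mset k M))"
    using block.hyps(2) f(1) represents_nc_h represents_mult sym.complete_prod_block by simp
  moreover have "Poly_Mapping.lookup (f * nc_h N lt k) w =
      of_bool (w \<in> lists (alphabet N) \<and> compatible lt (m + replicate_mset k M) w)" for w
  proof -
    have "length v = size m" if "v \<in> Poly_Mapping.keys f" for v
      using that by (simp add: in_keys_iff f(2) compatible_def split: if_splits)
    then have "Poly_Mapping.lookup (f * nc_h N lt k) w =
        Poly_Mapping.lookup f (take (size m) w) * Poly_Mapping.lookup (nc_h N lt k) (drop (size m) w)"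
      by (rule lookup_mult_homogeneous)
    moreover have "w \<in> lists (alphabet N) \<longleftrightarrow>
        take (size m) w \<in> lists (alphabet N) \<and> drop (size m) w \<in> lists (alphabet N)"
      by (metis append_in_lists_conv append_take_drop_id)
    moreover have "compatible lt (m + replicate_mset k M) w \<longleftrightarrow>
        compatible lt m (take (size m) w) \<and> length (drop (size m) w) = k \<and>
        successively (\<lambda>x y. \<not> col_ge lt x y) (drop (size m) w)"
      by (rule compatible_block) (rule block.hyps(1))
    ultimately show ?thesis
      by (simp only: f(2) lookup_nc_h of_bool_conj[symmetric]) (simp only: conj_ac)
  qed
  ultimately show ?case by blast
qed

text \<open>Any representative of the product can replace the sum of the compatible words. Symmetry
  and expansion both come from this freedom.\<close>

lemma F_series_eq_pairing_represents:
  assumes "0 \<notin># m" "represents g (sym.complete_prod m)"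
  shows "F_series lt \<gamma> m = pairing g \<gamma>"
proof -
  obtain f where f: "represents f (sym.complete_prod m)"
    "\<And>w. Poly_Mapping.lookup f w = of_bool (w \<in> lists (alphabet N) \<and> compatible lt m w)"
    using represents_compatible_words by blast
  have "Poly_Mapping.keys \<gamma> \<subseteq> lists (alphabet N)"
    using orth by (simp add: orth_compl_def U_def U_carrier_def)
  then have "F_series lt \<gamma> m = pairing f \<gamma>"
    using assms(1) f(2) by (intro F_series_eq_pairing)
  then show ?thesis using pairing_represents[OF f(1) assms(2)] by simp
qed

lemma symmetric_F_series: "symmetric_series (F_series lt \<gamma>)"
  unfolding symmetric_series_def
proof (intro allI impI)
  fix \<pi> :: "nat \<Rightarrow> nat" and m assume \<pi>: "\<pi> permutes {1..}"
  have 0: "0 \<in># image_mset \<pi> m \<longleftrightarrow> 0 \<in># m"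
  proof -
    have "\<pi> 0 = 0" using \<pi> by (auto simp: permutes_def)
    then have "\<pi> x = 0 \<longleftrightarrow> x = 0" for x using permutes_inj[OF \<pi>] by (metis injD)
    then show ?thesis by (auto simp: image_iff eq_commute[of 0])
  qed
  show "F_series lt \<gamma> (image_mset \<pi> m) = F_series lt \<gamma> m"
  proof (cases "0 \<in># m")
    case True
    then show ?thesis using 0 by (simp only: F_series_zero_index)
  next
    case False
    \<comment> \<open>One representative serves both \<open>m\<close> and its image, which have the
      same \<open>complete_prod\<close>.\<close>
    obtain f where "represents f (sym.complete_prod m)" using represents_compatible_words by blast
    then show ?thesis
      using F_series_eq_pairing_represents[of _ f] False 0
        complete_prod_image_mset[OF permutes_inj[OF \<pi>], of m] by simp
  qed
qed

text \<open>At a fixed monomial only the finitely many shapes of tableaux with content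
  \<open>m\<close> contribute; \<open>schur \<nu> m\<close> vanishes for every other
  partition.\<close>

lemma has_sum_schur:
  "((\<lambda>\<nu>. schur \<nu> m * pairing (nc_schur N lt \<nu>) \<gamma>) has_sum F_series lt \<gamma> m) {\<nu>. is_partition \<nu>}"
proof (cases "0 \<in># m")
  case True
  then show ?thesis by (simp add: F_series_zero_index schur_zero_index)
next
  case False
  let ?g = "\<lambda>\<nu>. schur \<nu> m * pairing (nc_schur N lt \<nu>) \<gamma>"
  let ?S = "shape ` tableaux m"
  note cp = sym.complete_prod_eq_sum_schur[OF False]
  have "represents (\<Sum>\<nu>\<in>?S. of_int (schur \<nu> m) * nc_schur N lt \<nu>) (sym.complete_prod m)"
    unfolding cp(2) by (intro represents_sum represents_mult represents_of_int represents_nc_schur)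
  then have "F_series lt \<gamma> m = sum ?g ?S"
    using F_series_eq_pairing_represents[OF False] by (simp add: pairing_sum pairing_of_int_mult)
  then have "(?g has_sum F_series lt \<gamma> m) ?S"
    using has_sum_finite[OF cp(1)] by simp
  then show ?thesis
  proof (rule has_sum_cong_neutral[THEN iffD1, rotated -1])
    fix \<nu> assume "\<nu> \<in> {\<nu>. is_partition \<nu>} - ?S"
    then have "is_partition \<nu>" "{T \<in> tableaux m. shape T = \<nu>} = {}" by auto
    then have "schur \<nu> m = 0" by (simp only: schur_eq_card_tableaux card.empty of_nat_0)
    then show "?g \<nu> = 0" by simp
  next
    fix \<nu> assume "\<nu> \<in> ?S - {\<nu>. is_partition \<nu>}"
    then show "?g \<nu> = 0" using is_partition_shape by (auto simp: tableaux_def)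
  qed simp
qed

end

theorem theorem3p12:
  fixes N :: nat
    and lt :: "letter \<Rightarrow> letter \<Rightarrow> bool"
    and \<gamma> :: nc_poly
  assumes "shuffle_order N lt"
    and "\<gamma> \<in> orth_compl N (plac_ideal N lt)"
  shows "symmetric_series (F_series lt \<gamma>) \<and>
         (\<forall>m. ((\<lambda>\<nu>. schur \<nu> m * pairing (nc_schur N lt \<nu>) \<gamma>) has_sum F_series lt \<gamma> m)
                {\<nu>. is_partition \<nu>})"
proof -
  interpret plactic_annihilator N lt \<gamma>
    using assms by unfold_locales
  show ?thesis
    using symmetric_F_series has_sum_schur by blast
qed

end
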